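(* Let $E=\mathcal{P}_2(\mathbb{R}^d)$ be the space of Borel probability measures on $\mathbb{R}^d$ with finite second moment, equipped with the Kantorovich–Wasserstein distance $W_2$. Let $F:[0,+\infty)\to\mathbb{R}$, $V:\mathbb{R}^d\to\mathbb{R}$, $W:\mathbb{R}^d\to[0,\infty)$ satisfy: (a) $F$ is convex, differentiable, with superlinear growth; there is $C>0$ with $F(z+w)\le C(1+F(z)+F(w))$ for all $z,w\ge0$; the map $s\mapsto s^dF(s^{-d})$ is convex and nonincreasing on $(0,+\infty)$; $F(0)=0$; and $\lim_{s\downarrow0}F(s)/s^{\alpha}>-\infty$ for some $\alpha>\frac{d}{d+2}$. (b) $V$ is lower semi-continuous and $\kappa_V$-convex for some $\kappa_V\in\mathbb{R}$. (c) $W$ is even, continuously differentiable, $\kappa_W$-convex for some $\kappa_W\ge0$, and there is $C>0$ with $W(x+y)\le C(1+W(x)+W(y))$ for all $x,y\in\mathbb{R}^d$. Let $$\mathcal{E}(\rho)=\int F\Big(\frac{d\rho}{d\mathscr{L}^d}(x)\Big)dx+\int V(x)\,\rho(dx)+\frac12\int\!\!\int W(x-y)\,\rho(dx)\rho(dy)$$ if $\rho$ is absolutely continuous with respect to the Lebesgue measure $\mathscr{L}^d$, and $\mathcal{E}(\rho)=+\infty$ otherwise. Put $d=W_2$ and $\kappa=\kappa_V+\kappa_W$. Then for every $\lambda>0$, all bounded and uniformly continuous $h^\dagger,h^\ddagger:E\to\mathbb{R}$, every viscosity subsolution $u:E\to\mathbb{R}$ to $f-\lambda H_\dagger f=h^\dagger$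 and every viscosity supersolution $v:E\to\mathbb{R}$ to $f-\lambda H_\ddagger f=h^\ddagger$, $$\sup_{\pi\in E}\big(u(\pi)-v(\pi)\big)\le\sup_{\pi\in E}\big(h^\dagger(\pi)-h^\ddagger(\pi)\big).$$
   Context: $W_2^2(\mu,\nu)=\inf_{\pi\in\Pi(\mu,\nu)}\int|x-y|^2\pi(dx\,dy)$, with $\Pi(\mu,\nu)$ the couplings of $\mu,\nu$. A function $\phi$ on $\mathbb{R}^d$ is $k$-convex if $\phi((1-t)x+ty)\le(1-t)\phi(x)+t\phi(y)-\frac{k}{2}t(1-t)|x-y|^2$ for all $x,y\in\mathbb{R}^d$, $t\in[0,1]$. Domain: $\mathcal{D}(\mathcal{E})=\{\pi\in E:\mathcal{E}(\pi)<+\infty\}$. EVI gradient flow: a solution of $EVI_\kappa$ is a continuous curve $\gamma:[0,+\infty)\to E$ with $\gamma((0,+\infty))\subseteq\mathcal{D}(\mathcal{E})$ such that for all $\rho\in\mathcal{D}(\mathcal{E})$, $t\in[0,+\infty)$, $$\frac12\frac{d^+}{dt}d^2(\gamma(t),\rho)\le\mathcal{E}(\rho)-\mathcal{E}(\gamma(t))-\frac{\kappa}{2}d^2(\gamma(t),\rho),$$ where $\frac{d^+}{dt}$ is the upper right time derivative. An $EVI_\kappa$ gradient flow of $\mathcal{E}$ on $E$ is a family of continuous maps $S(t):E\to E$, $t\ge0$, such that for every $\pi\in E$: $S[\pi](0)=\pi$, $S[\pi](t+s)=S[S[\pi](t)](s)$ for $s,t\ge0$, and $t\mapsto S[\pi](t)$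 is a solution of $EVI_\kappa$. One writes $\pi(t):=S[\pi](t)$. In the setting of the claim this flow exists and is unique (known from the theory of Ambrosio–Gigli–Savaré), and it is the one used below. Tataru distance: with $\hat\kappa=\min(0,\kappa)$, $d_T(\pi,\rho)=\inf_{t\ge0}\{t+e^{\hat\kappa t}d(\pi,\rho(t))\}$ for $\pi,\rho\in E$. Hamiltonians: $H_\dagger$ is the set of all pairs $(f^\dagger,g^\dagger)$ of functions on $E$, indexed by $a,b>0$, $c\in\mathbb{R}$, $\mu,\rho\in E$ with $\mathcal{E}(\rho)<\infty$, of the form $$f^\dagger(\pi)=\tfrac12 a\,d^2(\pi,\rho)+b\,d_T(\pi,\mu)+c,$$ $$g^\dagger(\pi)=a[\mathcal{E}(\rho)-\mathcal{E}(\pi)]-a\tfrac{\kappa}{2}d^2(\pi,\rho)+b+\tfrac12a^2d^2(\pi,\rho)+ab\,d(\pi,\rho)+\tfrac12b^2.$$ $H_\ddagger$ is the set of all pairs $(f^\ddagger,g^\ddagger)$, indexed by $a,b>0$, $c\in\mathbb{R}$, $\pi,\gamma\in E$ with $\mathcal{E}(\gamma)<\infty$, of the form $$f^\ddagger(\mu)=-\tfrac12a\,d^2(\gamma,\mu)-b\,d_T(\mu,\pi)+c,$$ $$g^\ddagger(\mu)=a[\mathcal{E}(\mu)-\mathcal{E}(\gamma)]+a\tfrac{\kappa}{2}d^2(\gamma,\mu)-b+\tfrac12a^2d^2(\gamma,\mu)-ab\,d(\gamma,\mu)-\tfrac12b^2.$$ Viscosity solutions: $u$ is a (viscosity) subsolution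 of $f-\lambda H_\dagger f=h^\dagger$ if $u$ is bounded, upper semi-continuous and for all $(f,g)\in H_\dagger$ there is a sequence $(\pi_n)$ in $E$ with $\lim_n (u(\pi_n)-f(\pi_n))=\sup_\pi (u(\pi)-f(\pi))$ and $\limsup_n (u(\pi_n)-\lambda g(\pi_n)-h^\dagger(\pi_n))\le0$. $v$ is a (viscosity) supersolution of $f-\lambda H_\ddagger f=h^\ddagger$ if $v$ is bounded, lower semi-continuous and for all $(f,g)\in H_\ddagger$ there is a sequence $(\pi_n)$ in $E$ with $\lim_n (v(\pi_n)-f(\pi_n))=\inf_\pi (v(\pi)-f(\pi))$ and $\liminf_n (v(\pi_n)-\lambda g(\pi_n)-h^\ddagger(\pi_n))\ge0$. *)

theory Defs
  imports "HOL-Probability.Probability"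
begin

section \<open>Functions on a space \<open>E\<close> with distance \<open>d\<close>\<close>

text \<open>A space is a carrier \<open>E\<close> with a distance \<open>d\<close>; all conditions are relative to the carrier.\<close>

definition usc_on :: "'e set \<Rightarrow> ('e \<Rightarrow> 'e \<Rightarrow> real) \<Rightarrow> ('e \<Rightarrow> real) \<Rightarrow> bool" where
  "usc_on E d u \<longleftrightarrow>
     (\<forall>\<pi>\<in>E. \<forall>e>0. \<exists>r>0. \<forall>\<rho>\<in>E. d \<pi> \<rho> < r \<longrightarrow> u \<rho> < u \<pi> + e)"

definition lsc_on :: "'e set \<Rightarrow> ('e \<Rightarrow> 'e \<Rightarrow> real) \<Rightarrow> ('e \<Rightarrow> real) \<Rightarrow> bool" where
  "lsc_on E d v \<longleftrightarrow>
     (\<forall>\<pi>\<in>E. \<forall>e>0. \<exists>r>0. \<forall>\<rho>\<in>E. d \<pi> \<rho> < r \<longrightarrow> v \<pi> - e < v \<rho>)"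

definition uniformly_cont_on :: "'e set \<Rightarrow> ('e \<Rightarrow> 'e \<Rightarrow> real) \<Rightarrow> ('e \<Rightarrow> real) \<Rightarrow> bool" where
  "uniformly_cont_on E d h \<longleftrightarrow>
     (\<forall>e>0. \<exists>r>0. \<forall>\<pi>\<in>E. \<forall>\<rho>\<in>E. d \<pi> \<rho> < r \<longrightarrow> \<bar>h \<pi> - h \<rho>\<bar> < e)"


section \<open>EVI gradient flows\<close>

text \<open>
  Energies take values in \<open>ereal\<close>; the value \<open>+\<infinity>\<close> marks points outside the domain.
\<close>

definition energy_dom :: "'e set \<Rightarrow> ('e \<Rightarrow> ereal) \<Rightarrow> 'e set" where
  "energy_dom E en = {\<pi> \<in> E. en \<pi> < \<infinity>}"

definition upper_right_deriv :: "(real \<Rightarrow> real) \<Rightarrow> real \<Rightarrow> ereal" where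
  "upper_right_deriv f t = Limsup (at_right 0) (\<lambda>h. ereal ((f (t + h) - f t) / h))"

text \<open>
  The inequality is read in \<open>ereal\<close>: at \<open>t = 0\<close> the energy of \<open>\<gamma> 0\<close> may be \<open>+\<infinity>\<close>, in which case
  the right-hand side is \<open>-\<infinity>\<close>.
\<close>

definition EVI_solution ::
    "'e set \<Rightarrow> ('e \<Rightarrow> 'e \<Rightarrow> real) \<Rightarrow> ('e \<Rightarrow> ereal) \<Rightarrow> real \<Rightarrow> (real \<Rightarrow> 'e) \<Rightarrow> bool" where
  "EVI_solution E d en \<kappa> \<gamma> \<longleftrightarrow>
     (\<forall>t\<ge>0. \<gamma> t \<in> E) \<and>
     (\<forall>t\<ge>0. \<forall>e>0. \<exists>r>0. \<forall>s\<ge>0. \<bar>s - t\<bar> < r \<longrightarrow> d (\<gamma> t) (\<gamma> s) < e) \<and>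
     (\<forall>t>0. \<gamma> t \<in> energy_dom E en) \<and>
     (\<forall>\<rho>\<in>energy_dom E en. \<forall>t\<ge>0.
        ereal (1/2) * upper_right_deriv (\<lambda>s. (d (\<gamma> s) \<rho>)\<^sup>2) t
          \<le> en \<rho> - en (\<gamma> t) - ereal (\<kappa> / 2 * (d (\<gamma> t) \<rho>)\<^sup>2))"

text \<open>The argument order is \<open>S t \<pi>\<close> for the point \<open>S[\<pi>](t)\<close>.\<close>

definition EVI_gradient_flow ::
    "'e set \<Rightarrow> ('e \<Rightarrow> 'e \<Rightarrow> real) \<Rightarrow> ('e \<Rightarrow> ereal) \<Rightarrow> real \<Rightarrow> (real \<Rightarrow> 'e \<Rightarrow> 'e) \<Rightarrow> bool" where
  "EVI_gradient_flow E d en \<kappa> S \<longleftrightarrow>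
     (\<forall>t\<ge>0. \<forall>\<pi>\<in>E. S t \<pi> \<in> E) \<and>
     (\<forall>t\<ge>0. \<forall>\<pi>\<in>E. \<forall>e>0. \<exists>r>0. \<forall>\<rho>\<in>E. d \<pi> \<rho> < r \<longrightarrow> d (S t \<pi>) (S t \<rho>) < e) \<and>
     (\<forall>\<pi>\<in>E. S 0 \<pi> = \<pi>) \<and>
     (\<forall>\<pi>\<in>E. \<forall>s\<ge>0. \<forall>t\<ge>0. S (t + s) \<pi> = S s (S t \<pi>)) \<and>
     (\<forall>\<pi>\<in>E. EVI_solution E d en \<kappa> (\<lambda>t. S t \<pi>))"


section \<open>Tataru distance, Hamiltonians and viscosity solutions\<close>

text \<open>Only the second argument is moved along the flow, so the Tataru distance is not symmetric.\<close>

definition tataru :: "('e \<Rightarrow> 'e \<Rightarrow> real) \<Rightarrow> (real \<Rightarrow> 'e \<Rightarrow> 'e) \<Rightarrow> real \<Rightarrow> 'e \<Rightarrow> 'e \<Rightarrow> real" where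
  "tataru d S \<kappa> \<pi> \<rho> = (INF t\<in>{0..}. t + exp (min 0 \<kappa> * t) * d \<pi> (S t \<rho>))"

definition H_dagger ::
    "'e set \<Rightarrow> ('e \<Rightarrow> 'e \<Rightarrow> real) \<Rightarrow> ('e \<Rightarrow> ereal) \<Rightarrow> (real \<Rightarrow> 'e \<Rightarrow> 'e) \<Rightarrow> real \<Rightarrow>
      (('e \<Rightarrow> real) \<times> ('e \<Rightarrow> ereal)) set" where
  "H_dagger E d en S \<kappa> =
     {(\<lambda>\<pi>. 1/2 * a * (d \<pi> \<rho>)\<^sup>2 + b * tataru d S \<kappa> \<pi> \<mu> + c,
       \<lambda>\<pi>. ereal a * (en \<rho> - en \<pi>)
            + ereal (- a * (\<kappa> / 2) * (d \<pi> \<rho>)\<^sup>2 + b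
                     + 1/2 * a\<^sup>2 * (d \<pi> \<rho>)\<^sup>2 + a * b * d \<pi> \<rho> + 1/2 * b\<^sup>2))
      | a b c \<mu> \<rho>. a > 0 \<and> b > 0 \<and> \<mu> \<in> E \<and> \<rho> \<in> E \<and> en \<rho> < \<infinity>}"

definition H_ddagger ::
    "'e set \<Rightarrow> ('e \<Rightarrow> 'e \<Rightarrow> real) \<Rightarrow> ('e \<Rightarrow> ereal) \<Rightarrow> (real \<Rightarrow> 'e \<Rightarrow> 'e) \<Rightarrow> real \<Rightarrow>
      (('e \<Rightarrow> real) \<times> ('e \<Rightarrow> ereal)) set" where
  "H_ddagger E d en S \<kappa> =
     {(\<lambda>\<mu>. - 1/2 * a * (d \<gamma> \<mu>)\<^sup>2 - b * tataru d S \<kappa> \<mu> \<pi> + c,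
       \<lambda>\<mu>. ereal a * (en \<mu> - en \<gamma>)
            + ereal (a * (\<kappa> / 2) * (d \<gamma> \<mu>)\<^sup>2 - b
                     + 1/2 * a\<^sup>2 * (d \<gamma> \<mu>)\<^sup>2 - a * b * d \<gamma> \<mu> - 1/2 * b\<^sup>2))
      | a b c \<pi> \<gamma>. a > 0 \<and> b > 0 \<and> \<pi> \<in> E \<and> \<gamma> \<in> E \<and> en \<gamma> < \<infinity>}"

definition viscosity_subsolution ::
    "'e set \<Rightarrow> ('e \<Rightarrow> 'e \<Rightarrow> real) \<Rightarrow> (('e \<Rightarrow> real) \<times> ('e \<Rightarrow> ereal)) set \<Rightarrow> real \<Rightarrow>
      ('e \<Rightarrow> real) \<Rightarrow> ('e \<Rightarrow> real) \<Rightarrow> bool" where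
  "viscosity_subsolution E d H lam h u \<longleftrightarrow>
     bounded (u ` E) \<and> usc_on E d u \<and>
     (\<forall>(f, g)\<in>H. \<exists>p :: nat \<Rightarrow> 'e.
        (\<forall>n. p n \<in> E) \<and>
        (\<lambda>n. u (p n) - f (p n)) \<longlonglongrightarrow> (SUP \<pi>\<in>E. u \<pi> - f \<pi>) \<and>
        limsup (\<lambda>n. ereal (u (p n)) - ereal lam * g (p n) - ereal (h (p n))) \<le> 0)"

definition viscosity_supersolution ::
    "'e set \<Rightarrow> ('e \<Rightarrow> 'e \<Rightarrow> real) \<Rightarrow> (('e \<Rightarrow> real) \<times> ('e \<Rightarrow> ereal)) set \<Rightarrow> real \<Rightarrow>
      ('e \<Rightarrow> real) \<Rightarrow> ('e \<Rightarrow> real) \<Rightarrow> bool" where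
  "viscosity_supersolution E d H lam h v \<longleftrightarrow>
     bounded (v ` E) \<and> lsc_on E d v \<and>
     (\<forall>(f, g)\<in>H. \<exists>p :: nat \<Rightarrow> 'e.
        (\<forall>n. p n \<in> E) \<and>
        (\<lambda>n. v (p n) - f (p n)) \<longlonglongrightarrow> (INF \<pi>\<in>E. v \<pi> - f \<pi>) \<and>
        liminf (\<lambda>n. ereal (v (p n)) - ereal lam * g (p n) - ereal (h (p n))) \<ge> 0)"


section \<open>The Wasserstein space\<close>

definition P2 :: "'a::euclidean_space measure set" where
  "P2 = {\<mu>. prob_space \<mu> \<and> sets \<mu> = sets borel \<and> integrable \<mu> (\<lambda>x. (norm x)\<^sup>2)}"

definition couplings ::
    "'a::euclidean_space measure \<Rightarrow> 'a measure \<Rightarrow> ('a \<times> 'a) measure set" where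
  "couplings \<mu> \<nu> =
     {\<pi>. sets \<pi> = sets (borel \<Otimes>\<^sub>M borel) \<and> distr \<pi> borel fst = \<mu> \<and> distr \<pi> borel snd = \<nu>}"

text \<open>
  On \<open>P2\<close> the infimum is finite (the product coupling has finite cost), so \<open>enn2real\<close> loses nothing.
\<close>

definition W2 :: "'a::euclidean_space measure \<Rightarrow> 'a measure \<Rightarrow> real" where
  "W2 \<mu> \<nu> =
     sqrt (enn2real (INF \<pi>\<in>couplings \<mu> \<nu>. \<integral>\<^sup>+ z. ennreal ((norm (fst z - snd z))\<^sup>2) \<partial>\<pi>))"


section \<open>The energy functional\<close>

definition k_convex :: "real \<Rightarrow> ('a::euclidean_space \<Rightarrow> real) \<Rightarrow> bool" where
  "k_convex k \<phi> \<longleftrightarrow>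
     (\<forall>x y. \<forall>t\<in>{0..1}. \<phi> ((1 - t) *\<^sub>R x + t *\<^sub>R y)
        \<le> (1 - t) * \<phi> x + t * \<phi> y - k / 2 * t * (1 - t) * (norm (x - y))\<^sup>2)"

text \<open>
  Integral with values in the extended reals: positive part minus negative part. It agrees with
  the Bochner integral on integrable functions and is \<open>+\<infinity>\<close> when only the positive part diverges.
  (If both parts diverge, the \<open>ereal\<close> subtraction returns \<open>+\<infinity>\<close>. For the energy below this does not
  occur: the growth condition on \<open>F\<close> at \<open>0\<close>, the \<open>k\<close>-convexity of \<open>V\<close> and the finite second moment
  make all negative parts integrable.)
\<close>

definition ext_integral :: "'b measure \<Rightarrow> ('b \<Rightarrow> real) \<Rightarrow> ereal" where
  "ext_integral M f =
     enn2ereal (\<integral>\<^sup>+ x. ennreal (f x) \<partial>M) - enn2ereal (\<integral>\<^sup>+ x. ennreal (- f x) \<partial>M)"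

definition energy ::
    "(real \<Rightarrow> real) \<Rightarrow> ('a::euclidean_space \<Rightarrow> real) \<Rightarrow> ('a \<Rightarrow> real) \<Rightarrow> 'a measure \<Rightarrow> ereal" where
  "energy F V W \<rho> =
     (if absolutely_continuous lborel \<rho>
      then ext_integral lborel (\<lambda>x. F (enn2real (RN_deriv lborel \<rho> x)))
           + ext_integral \<rho> V
           + ereal (1/2) * ext_integral (\<rho> \<Otimes>\<^sub>M \<rho>) (\<lambda>(x, y). W (x - y))
      else \<infinity>)"

text \<open>
  \<open>F\<close> is a total function of which only the values on \<open>[0, \<infinity>)\<close> matter. Differentiability is
  required on the open half-line only, so that \<open>F z = z * ln z\<close>, whose right derivative at \<open>0\<close> is
  \<open>-\<infinity>\<close>, is included.
\<close>

definition internal_energy_density :: "nat \<Rightarrow> (real \<Rightarrow> real) \<Rightarrow> bool" where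
  "internal_energy_density n F \<longleftrightarrow>
     convex_on {0..} F \<and> F differentiable_on {0<..} \<and>
     filterlim (\<lambda>z. F z / z) at_top at_top \<and>
     (\<exists>C>0. \<forall>z\<ge>0. \<forall>w\<ge>0. F (z + w) \<le> C * (1 + F z + F w)) \<and>
     convex_on {0<..} (\<lambda>s. s ^ n * F (inverse (s ^ n))) \<and>
     antimono_on {0<..} (\<lambda>s. s ^ n * F (inverse (s ^ n))) \<and>
     F 0 = 0 \<and>
     (\<exists>\<alpha> > real n / (real n + 2). \<exists>L > -\<infinity>.
        ((\<lambda>s. ereal (F s / s powr \<alpha>)) \<longlongrightarrow> L) (at_right 0))"

definition confinement_potential :: "real \<Rightarrow> ('a::euclidean_space \<Rightarrow> real) \<Rightarrow> bool" where
  "confinement_potential \<kappa>V V \<longleftrightarrow> lsc_on UNIV dist V \<and> k_convex \<kappa>V V"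

definition interaction_potential :: "real \<Rightarrow> ('a::euclidean_space \<Rightarrow> real) \<Rightarrow> bool" where
  "interaction_potential \<kappa>W W \<longleftrightarrow>
     (\<forall>x. W x \<ge> 0) \<and> (\<forall>x. W (- x) = W x) \<and>
     (\<exists>DW. continuous_on UNIV DW \<and> (\<forall>x. GDERIV W x :> DW x)) \<and>
     \<kappa>W \<ge> 0 \<and> k_convex \<kappa>W W \<and>
     (\<exists>C>0. \<forall>x y. W (x + y) \<le> C * (1 + W x + W y))"

end

theory Submission
  imports Defs
begin

text \<open>
  The proof doubles variables through a third point. For a penalisation \<open>a\<close> consider the supremum of
  \<open>u(\<pi>) - v(\<mu>) - a/2 (d(\<pi>,\<rho>)\<^sup>2 + d(\<mu>,\<rho>)\<^sup>2)\<close> over \<open>\<pi>, \<mu>, \<rho>\<close>; it dominates \<open>sup (u - v)\<close>. At an almost optimal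
  triple \<open>u\<close> and \<open>v\<close> are tested with the same centre \<open>\<rho>\<close>. The difference of the two viscosity inequalities
  contains the energies in the form \<open>a (2 E(\<rho>) - E(\<pi>) - E(\<mu>))\<close>. Since \<open>\<rho>\<close> almost minimises the sum of its
  squared distances to \<open>\<pi>\<close> and \<open>\<mu>\<close>, the gradient flow started at \<open>\<rho>\<close> cannot decrease that sum at a
  substantial rate, and the EVI with centres \<open>\<pi>\<close> and \<open>\<mu>\<close> bounds the energy combination by
  \<open>- a \<kappa>/2 (d(\<pi>,\<rho>)\<^sup>2 + d(\<mu>,\<rho>)\<^sup>2)\<close>. The quadratic terms of the Hamiltonians cancel because \<open>\<rho>\<close> is almost a
  midpoint. The remaining penalty is small for suitable large \<open>a\<close>, and then \<open>\<pi>\<close> and \<open>\<mu>\<close> are close.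

  Optimal triples need not exist. Optimality of \<open>\<rho>\<close> is needed only in the direction of the flow, and
  for that a maximisation along one trajectory over a compact time interval suffices
  (\<open>flow_maximum_principle\<close>). The energy is not known to be lower semicontinuous along that trajectory, so its
  lower limit at the initial time takes the place of the initial energy (\<open>flow_start_energy\<close>); the
  viscosity inequalities are used at a nearby point of the trajectory that almost realises this
  limit (\<open>doubling_estimate\<close>).

  The argument takes place in an abstract pseudometric space with approximate midpoints and an
  energy bounded below by a quadratic function of the distance. For the Wasserstein space the
  triangle inequality comes from gluing couplings (\<open>W2_glue\<close>), midpoints from displacement
  interpolation (\<open>W2_midpoint\<close>), and the lower bound from the growth of \<open>F\<close> at \<open>0\<close>
  (\<open>energy_lower_bound\<close>).
\<close>

section \<open>Upper right derivatives\<close>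

text \<open>
  The mean value inequality for an upper right derivative: for any larger slope \<open>K'\<close>, the set of
  times up to which the increment from a fixed start \<open>s > 0\<close> stays below slope \<open>K'\<close> is closed, and
  the derivative bound lets one move past any point of it. The bound is only asked at interior
  times because the energy along a flow may behave badly at the initial time.
\<close>

lemma increment_le_of_upper_right_deriv:
  fixes \<phi> :: "real \<Rightarrow> real"
  assumes cont: "continuous_on {0..T} \<phi>"
    and deriv: "\<And>r. 0 < r \<Longrightarrow> r < T \<Longrightarrow> upper_right_deriv \<phi> r \<le> ereal K"
    and "0 < T"
  shows "\<phi> T - \<phi> 0 \<le> K * T"
proof -
  have step: "\<phi> T - \<phi> s \<le> K' * (T - s)" if "0 < s" "s < T" "K < K'" for s K'
  proof -
    define A where "A = {r \<in> {s..T}. \<phi> r - K' * r \<le> \<phi> s - K' * s}"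
    have "continuous_on {s..T} (\<lambda>r. \<phi> r - K' * r)"
      by (intro continuous_intros continuous_on_subset[OF cont]) (use that in auto)
    then have "closed A"
      unfolding A_def by (intro continuous_on_closed_Collect_le) auto
    then have "compact (A \<inter> {s..T})"
      by (metis compact_Int_closed compact_Icc inf_commute)
    moreover have "A \<inter> {s..T} = A"
      by (auto simp: A_def)
    ultimately have "compact A" by simp
    moreover have "s \<in> A" using that by (auto simp: A_def)
    ultimately obtain x where x: "x \<in> A" "\<forall>y\<in>A. y \<le> x"
      using compact_attains_sup[of A] by blast
    \<comment> \<open>the last time at which slope \<open>K'\<close> is respected cannot be interior\<close>
    have "x = T"
    proof (rule ccontr)
      assume "x \<noteq> T"
      with x(1) have xT: "s \<le> x" "x < T" by (auto simp: A_def)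
      have "Limsup (at_right 0) (\<lambda>h. ereal ((\<phi> (x + h) - \<phi> x) / h)) < ereal K'"
        using order_le_less_trans[OF deriv[of x], of "ereal K'"] that xT
        unfolding upper_right_deriv_def by simp
      then have "\<forall>\<^sub>F h in at_right 0. ereal ((\<phi> (x + h) - \<phi> x) / h) < ereal K'"
        by (rule Limsup_lessD)
      moreover have "\<forall>\<^sub>F h in at_right (0::real). h < T - x"
        using xT by (intro eventually_at_right_real[THEN eventually_mono, of 0 "T - x"]) auto
      moreover have "\<forall>\<^sub>F h in at_right (0::real). h > 0"
        by (rule eventually_at_right_less)
      ultimately have "\<forall>\<^sub>F h in at_right (0::real). x + h \<in> A \<and> h > 0"
      proof eventually_elim
        case (elim h)
        then have "\<phi> (x + h) - \<phi> x < K' * h" by (simp add: field_simps)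
        with elim x(1) show ?case by (auto simp: A_def algebra_simps)
      qed
      then obtain h where "x + h \<in> A" "h > 0"
        by (metis (mono_tags, lifting) eventually_happens trivial_limit_at_right_real)
      with x(2) show False by fastforce
    qed
    with x(1) show ?thesis by (auto simp: A_def algebra_simps)
  qed
  have step2: "\<phi> T - \<phi> s \<le> K * (T - s)" if "0 < s" "s < T" for s
  proof (rule field_le_epsilon)
    fix e :: real assume "e > 0"
    have "\<phi> T - \<phi> s \<le> (K + e / (T - s)) * (T - s)"
      using that \<open>e > 0\<close> by (intro step) auto
    also have "\<dots> = K * (T - s) + e" using that by (simp add: field_simps)
    finally show "\<phi> T - \<phi> s \<le> K * (T - s) + e" .
  qed
  have "(\<phi> \<longlongrightarrow> \<phi> 0) (at 0 within {0..T})"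
    using cont \<open>0 < T\<close> by (auto simp: continuous_on_def)
  then have lim: "(\<phi> \<longlongrightarrow> \<phi> 0) (at_right 0)"
    using \<open>0 < T\<close> by (simp add: at_within_Icc_at_right)
  have "((\<lambda>s. K * (T - s) - (\<phi> T - \<phi> s)) \<longlongrightarrow> K * (T - 0) - (\<phi> T - \<phi> 0)) (at_right 0)"
    by (intro tendsto_intros lim)
  moreover have "\<forall>\<^sub>F s in at_right 0. 0 \<le> K * (T - s) - (\<phi> T - \<phi> s)"
    using eventually_at_right_real[OF \<open>0 < T\<close>] step2 by (auto elim!: eventually_mono)
  ultimately have "0 \<le> K * (T - 0) - (\<phi> T - \<phi> 0)"
    by (intro tendsto_lowerbound) auto
  then show ?thesis by simp
qed

section \<open>Spaces with an EVI gradient flow\<close>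

text \<open>
  What the comparison argument uses of the Wasserstein space: a pseudometric with approximate
  midpoints, an energy bounded below by a quadratic function of the distance, and an EVI flow.
  The lower bound excludes the value \<open>-\<infinity>\<close>, for which differences of energies, and with them the EVI and
  the Hamiltonians, are meaningless.
\<close>

locale EVI_length_space =
  fixes E :: "'e set" and d :: "'e \<Rightarrow> 'e \<Rightarrow> real" and en :: "'e \<Rightarrow> ereal"
    and S :: "real \<Rightarrow> 'e \<Rightarrow> 'e" and \<kappa> :: real
  assumes d_nonneg: "\<And>x y. 0 \<le> d x y"
    and d_refl: "\<And>x. x \<in> E \<Longrightarrow> d x x = 0"
    and d_sym: "\<And>x y. x \<in> E \<Longrightarrow> y \<in> E \<Longrightarrow> d x y = d y x"
    and d_tri: "\<And>x y z. x \<in> E \<Longrightarrow> y \<in> E \<Longrightarrow> z \<in> E \<Longrightarrow> d x z \<le> d x y + d y z"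
    and midpoint: "\<And>x y e. x \<in> E \<Longrightarrow> y \<in> E \<Longrightarrow> 0 < e \<Longrightarrow>
          \<exists>m\<in>E. d x m \<le> d x y / 2 + e \<and> d y m \<le> d x y / 2 + e"
    and energy_bound: "\<exists>\<sigma>\<in>E. \<exists>C. \<forall>\<rho>\<in>E. ereal (- C * (1 + (d \<rho> \<sigma>)\<^sup>2)) \<le> en \<rho>"
    and flow: "EVI_gradient_flow E d en \<kappa> S"
begin

abbreviation dom where "dom \<equiv> energy_dom E en"

lemma dom_E: "\<rho> \<in> dom \<Longrightarrow> \<rho> \<in> E"
  by (simp add: energy_dom_def)

lemma E_nonempty: "E \<noteq> {}"
  using energy_bound by auto

lemma energy_not_minf: "\<rho> \<in> E \<Longrightarrow> en \<rho> \<noteq> -\<infinity>"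
  using energy_bound by fastforce

lemma dom_ereal: "\<rho> \<in> dom \<Longrightarrow> en \<rho> = ereal (real_of_ereal (en \<rho>))"
  using energy_not_minf[of \<rho>] by (auto simp: energy_dom_def ereal_real)

lemma S_E: "0 \<le> t \<Longrightarrow> \<rho> \<in> E \<Longrightarrow> S t \<rho> \<in> E"
  and S_0: "\<rho> \<in> E \<Longrightarrow> S 0 \<rho> = \<rho>"
  and S_add: "\<rho> \<in> E \<Longrightarrow> 0 \<le> s \<Longrightarrow> 0 \<le> t \<Longrightarrow> S (t + s) \<rho> = S s (S t \<rho>)"
  using flow by (auto simp: EVI_gradient_flow_def)

lemma S_EVI: "\<rho> \<in> E \<Longrightarrow> EVI_solution E d en \<kappa> (\<lambda>t. S t \<rho>)"
  using flow by (auto simp: EVI_gradient_flow_def)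

lemma S_dom: "0 < t \<Longrightarrow> \<rho> \<in> E \<Longrightarrow> S t \<rho> \<in> dom"
  using S_EVI[of \<rho>] by (auto simp: EVI_solution_def)

lemma S_continuous:
  "\<rho> \<in> E \<Longrightarrow> 0 \<le> t \<Longrightarrow> 0 < e \<Longrightarrow> \<exists>r>0. \<forall>s\<ge>0. \<bar>s - t\<bar> < r \<longrightarrow> d (S t \<rho>) (S s \<rho>) < e"
  using S_EVI[of \<rho>] unfolding EVI_solution_def by blast

lemma flow_near_start:
  assumes "\<rho> \<in> E" "0 < e"
  shows "\<forall>\<^sub>F t in at_right 0. d \<rho> (S t \<rho>) < e"
proof -
  obtain r where r: "r > 0" "\<forall>s\<ge>0. \<bar>s - 0\<bar> < r \<longrightarrow> d (S 0 \<rho>) (S s \<rho>) < e"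
    using S_continuous[OF assms(1) order_refl assms(2)] by blast
  show ?thesis
    using eventually_at_right_real[OF r(1)] by eventually_elim (use r S_0[OF assms(1)] in auto)
qed

lemma d_diff_le: "x \<in> E \<Longrightarrow> y \<in> E \<Longrightarrow> z \<in> E \<Longrightarrow> \<bar>d x z - d y z\<bar> \<le> d x y"
  using d_tri[of x y z] d_tri[of y x z] d_sym[of x y] by linarith

lemma d_sq_diff_le:
  assumes "x \<in> E" "y \<in> E" "z \<in> E" and "d x z \<le> R" and "d x y \<le> \<delta>" "\<delta> \<le> 1"
  shows "\<bar>(d y z)\<^sup>2 - (d x z)\<^sup>2\<bar> \<le> \<delta> * (2 * R + 1)"
proof -
  have 1: "\<bar>d y z - d x z\<bar> \<le> \<delta>"
    using d_diff_le[OF assms(1-3)] assms(5) by linarith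
  have 2: "\<bar>d y z + d x z\<bar> \<le> 2 * R + 1"
    using 1 assms d_nonneg[of y z] d_nonneg[of x z] by linarith
  have "\<bar>(d y z)\<^sup>2 - (d x z)\<^sup>2\<bar> = \<bar>d y z - d x z\<bar> * \<bar>d y z + d x z\<bar>"
    by (simp add: abs_mult[symmetric] power2_eq_square algebra_simps)
  also have "\<dots> \<le> \<delta> * (2 * R + 1)"
    using 1 2 by (intro mult_mono) auto
  finally show ?thesis .
qed

text \<open>
  The hypothesis is continuity of \<open>f\<close> for the pseudometric \<open>d\<close>, spelled out because \<open>E\<close> carries no
  topology.
\<close>

lemma continuous_on_flow:
  assumes "\<rho> \<in> E"
    and f: "\<And>x e. x \<in> E \<Longrightarrow> 0 < e \<Longrightarrow> \<exists>r>0. \<forall>y\<in>E. d x y < r \<longrightarrow> \<bar>f y - f x\<bar> < e"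
  shows "continuous_on {0..} (\<lambda>t. f (S t \<rho>) :: real)"
  unfolding continuous_on_iff
proof (intro ballI allI impI)
  fix t e :: real assume "t \<in> {0..}" and e: "0 < e"
  then have te: "0 \<le> t" "0 < e" by auto
  obtain r where r: "r > 0" "\<forall>y\<in>E. d (S t \<rho>) y < r \<longrightarrow> \<bar>f y - f (S t \<rho>)\<bar> < e"
    using f[of "S t \<rho>" e] te assms(1) S_E by blast
  obtain r' where r': "r' > 0" "\<forall>s\<ge>0. \<bar>s - t\<bar> < r' \<longrightarrow> d (S t \<rho>) (S s \<rho>) < r"
    using S_continuous[OF assms(1) te(1) r(1)] by blast
  show "\<exists>r>0. \<forall>s\<in>{0..}. dist s t < r \<longrightarrow> dist (f (S s \<rho>)) (f (S t \<rho>)) < e"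
    using r r' S_E[OF _ assms(1)] by (auto simp: dist_real_def intro!: exI[of _ r'])
qed

lemma continuous_on_flow_d:
  assumes "\<rho> \<in> E" "\<pi> \<in> E"
  shows "continuous_on {0..} (\<lambda>t. d (S t \<rho>) \<pi>)"
proof (rule continuous_on_flow[OF assms(1)])
  fix x and e :: real assume "x \<in> E" "0 < e"
  then show "\<exists>r>0. \<forall>y\<in>E. d x y < r \<longrightarrow> \<bar>d y \<pi> - d x \<pi>\<bar> < e"
    using d_diff_le[of x _ \<pi>] assms(2) by (intro exI[of _ e]) (auto simp: abs_minus_commute intro: le_less_trans)
qed

text \<open>
  The EVI is only a pointwise bound on an upper derivative. With constant lower bounds \<open>m\<close> for the
  energy and \<open>q\<close> for the curvature term it integrates by the mean value inequality, and no integral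
  of the energy along the flow has to make sense.
\<close>

lemma EVI_integrated:
  assumes \<rho>: "\<rho> \<in> E" and \<pi>: "\<pi> \<in> dom" and "0 < T"
    and m: "\<And>r. 0 < r \<Longrightarrow> r < T \<Longrightarrow> ereal m \<le> en (S r \<rho>)"
    and q: "\<And>r. 0 < r \<Longrightarrow> r < T \<Longrightarrow> q \<le> \<kappa> / 2 * (d (S r \<rho>) \<pi>)\<^sup>2"
  shows "(d (S T \<rho>) \<pi>)\<^sup>2 / 2 - (d \<rho> \<pi>)\<^sup>2 / 2 \<le> (real_of_ereal (en \<pi>) - m - q) * T"
proof -
  let ?p = "real_of_ereal (en \<pi>)"
  have "(d (S T \<rho>) \<pi>)\<^sup>2 - (d (S 0 \<rho>) \<pi>)\<^sup>2 \<le> (2 * (?p - m - q)) * T"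
  proof (rule increment_le_of_upper_right_deriv)
    show "continuous_on {0..T} (\<lambda>r. (d (S r \<rho>) \<pi>)\<^sup>2)"
      by (intro continuous_intros continuous_on_subset[OF continuous_on_flow_d]) (use assms dom_E in auto)
    fix r assume r: "0 < r" "r < T"
    define D where "D = upper_right_deriv (\<lambda>r. (d (S r \<rho>) \<pi>)\<^sup>2) r"
    obtain x where x: "en (S r \<rho>) = ereal x"
      using dom_ereal[OF S_dom[OF r(1) \<rho>]] by blast
    have "ereal (1/2) * D \<le> en \<pi> - en (S r \<rho>) - ereal (\<kappa> / 2 * (d (S r \<rho>) \<pi>)\<^sup>2)"
      unfolding D_def using S_EVI[OF \<rho>] \<pi> r by (auto simp: EVI_solution_def)
    also have "\<dots> = ereal (?p - x - \<kappa> / 2 * (d (S r \<rho>) \<pi>)\<^sup>2)"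
      by (subst dom_ereal[OF \<pi>]) (simp add: x)
    also have "\<dots> \<le> ereal (?p - m - q)"
      using m[OF r] q[OF r] x by simp
    finally show "D \<le> ereal (2 * (?p - m - q))"
      by (cases D) auto
  qed fact
  then show ?thesis using S_0[OF \<rho>] by (simp add: algebra_simps)
qed

text \<open>
  The number \<open>l\<close> is the lower limit of the energy along the flow as the time tends to \<open>0\<close>. It
  replaces lower semicontinuity: near the start the energy is almost bounded below by \<open>l\<close>, while
  points of energy almost \<open>l\<close> occur arbitrarily close to \<open>\<rho>\<close>. That \<open>l\<close> is not \<open>-\<infinity>\<close> comes from the
  quadratic lower bound. It is not \<open>+\<infinity>\<close> because the EVI centred at \<open>\<rho>\<close> itself would otherwise make
  the squared distance to \<open>\<rho>\<close> negative.
\<close>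

lemma flow_start_energy:
  assumes \<rho>: "\<rho> \<in> dom"
  obtains l :: real where
    "\<And>\<eta>. 0 < \<eta> \<Longrightarrow> \<forall>\<^sub>F t in at_right 0. ereal (l - \<eta>) \<le> en (S t \<rho>)"
    "\<And>\<eta>. 0 < \<eta> \<Longrightarrow> \<exists>\<^sub>F t in at_right 0. en (S t \<rho>) < ereal (l + \<eta>)"
proof -
  define L where "L = Liminf (at_right 0) (\<lambda>t. en (S t \<rho>))"
  note \<rho>E = dom_E[OF \<rho>]
  note near = flow_near_start[OF \<rho>E]
  have "L \<noteq> -\<infinity>"
  proof -
    obtain \<sigma> C where \<sigma>: "\<sigma> \<in> E" and C: "\<And>\<rho>. \<rho> \<in> E \<Longrightarrow> ereal (- C * (1 + (d \<rho> \<sigma>)\<^sup>2)) \<le> en \<rho>"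
      using energy_bound by blast
    have "\<forall>\<^sub>F t in at_right 0. ereal (- \<bar>C\<bar> * (1 + (d \<rho> \<sigma> + 1)\<^sup>2)) \<le> en (S t \<rho>)"
      using near[of 1, simplified] eventually_at_right_less[of 0]
    proof eventually_elim
      case (elim t)
      then have SE: "S t \<rho> \<in> E" using S_E \<rho>E by simp
      then have "d (S t \<rho>) \<sigma> \<le> d \<rho> \<sigma> + 1"
        using d_tri[of "S t \<rho>" \<rho> \<sigma>] d_sym[of "S t \<rho>" \<rho>] elim \<rho>E \<sigma> by simp
      then have "1 + (d (S t \<rho>) \<sigma>)\<^sup>2 \<le> 1 + (d \<rho> \<sigma> + 1)\<^sup>2"
        using d_nonneg by (intro add_left_mono power_mono) auto
      then have "C * (1 + (d (S t \<rho>) \<sigma>)\<^sup>2) \<le> \<bar>C\<bar> * (1 + (d \<rho> \<sigma> + 1)\<^sup>2)"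
        by (intro mult_mono) auto
      then have "ereal (- \<bar>C\<bar> * (1 + (d \<rho> \<sigma> + 1)\<^sup>2)) \<le> ereal (- C * (1 + (d (S t \<rho>) \<sigma>)\<^sup>2))"
        by simp
      also have "\<dots> \<le> en (S t \<rho>)" by (rule C[OF SE])
      finally show ?case .
    qed
    then have "ereal (- \<bar>C\<bar> * (1 + (d \<rho> \<sigma> + 1)\<^sup>2)) \<le> L"
      unfolding L_def by (rule Liminf_bounded)
    then show ?thesis by auto
  qed
  moreover have "L \<noteq> \<infinity>"
  proof
    assume "L = \<infinity>"
    define p where "p = real_of_ereal (en \<rho>)"
    have "\<forall>\<^sub>F t in at_right 0. ereal (p + 1) < en (S t \<rho>)"
      by (rule less_LiminfD) (use \<open>L = \<infinity>\<close> in \<open>simp add: L_def\<close>)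
    moreover have "\<forall>\<^sub>F t in at_right 0. d \<rho> (S t \<rho>) < 1 / (1 + \<bar>\<kappa>\<bar>)"
      by (rule near) auto
    ultimately have "\<forall>\<^sub>F t in at_right 0. ereal (p + 1) < en (S t \<rho>) \<and> d \<rho> (S t \<rho>) < 1 / (1 + \<bar>\<kappa>\<bar>)"
      by (rule eventually_conj)
    then obtain T where T: "T > 0"
      "\<And>t. 0 < t \<Longrightarrow> t < T \<Longrightarrow> ereal (p + 1) < en (S t \<rho>) \<and> d \<rho> (S t \<rho>) < 1 / (1 + \<bar>\<kappa>\<bar>)"
      unfolding eventually_at_right_field by auto
    have "(d (S T \<rho>) \<rho>)\<^sup>2 / 2 - (d \<rho> \<rho>)\<^sup>2 / 2 \<le> (real_of_ereal (en \<rho>) - (p + 1) - (-1/2)) * T"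
    proof (rule EVI_integrated[OF \<rho>E \<rho> T(1)])
      fix r assume r: "0 < r" "r < T"
      from T(2)[OF r] show "ereal (p + 1) \<le> en (S r \<rho>)" by (simp add: less_imp_le)
      have D: "d (S r \<rho>) \<rho> \<le> 1 / (1 + \<bar>\<kappa>\<bar>)"
        using T(2)[OF r] d_sym[of "S r \<rho>" \<rho>] S_E[of r \<rho>] \<rho>E r by auto
      moreover have "1 / (1 + \<bar>\<kappa>\<bar>) \<le> 1" by simp
      ultimately have D1: "d (S r \<rho>) \<rho> \<le> 1" by linarith
      have "(d (S r \<rho>) \<rho>)\<^sup>2 \<le> 1 / (1 + \<bar>\<kappa>\<bar>) * 1"
        unfolding power2_eq_square using D D1 d_nonneg by (intro mult_mono) auto
      then have "\<bar>\<kappa>\<bar> * (d (S r \<rho>) \<rho>)\<^sup>2 \<le> \<bar>\<kappa>\<bar> * (1 / (1 + \<bar>\<kappa>\<bar>))"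
        by (intro mult_left_mono) auto
      also have "\<dots> \<le> 1" by simp
      finally have "- (\<kappa> * (d (S r \<rho>) \<rho>)\<^sup>2) \<le> 1"
        by (smt (verit) mult_minus_left mult_right_mono zero_le_power2)
      then show "-1/2 \<le> \<kappa> / 2 * (d (S r \<rho>) \<rho>)\<^sup>2" by simp
    qed
    then have "(d (S T \<rho>) \<rho>)\<^sup>2 \<le> - T"
      using d_refl[OF \<rho>E] by (simp add: p_def)
    with T(1) show False
      using zero_le_power2[of "d (S T \<rho>) \<rho>"] by linarith
  qed
  ultimately obtain l where l: "L = ereal l" by (cases L) auto
  show ?thesis
  proof (rule that[of l])
    fix \<eta> :: real assume "0 < \<eta>"
    show "\<forall>\<^sub>F t in at_right 0. ereal (l - \<eta>) \<le> en (S t \<rho>)"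
    proof (rule eventually_mono)
      show "\<forall>\<^sub>F t in at_right 0. ereal (l - \<eta>) < en (S t \<rho>)"
        by (rule less_LiminfD) (use l \<open>0 < \<eta>\<close> in \<open>simp add: L_def\<close>)
    qed simp
    show "\<exists>\<^sub>F t in at_right 0. en (S t \<rho>) < ereal (l + \<eta>)"
    proof (rule ccontr)
      assume "\<not> ?thesis"
      then have "\<forall>\<^sub>F t in at_right 0. ereal (l + \<eta>) \<le> en (S t \<rho>)"
        by (simp add: not_frequently not_less)
      then have "ereal (l + \<eta>) \<le> L" unfolding L_def by (rule Liminf_bounded)
      with l \<open>0 < \<eta>\<close> show False by simp
    qed
  qed
qed

text \<open>
  A substitute for a maximum of \<open>G\<close>, and for the Ekeland principle in the Tataru distance: an almost
  maximal point from which the flow cannot increase \<open>G\<close> faster than at rate \<open>b\<close>. It is found on one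
  single trajectory, started at an almost maximal point, by maximising \<open>G (S s \<rho>1) - b * s\<close> over the
  compact time interval \<open>{0..1}\<close>. The maximum is not attained at time \<open>1\<close>, since \<open>G\<close> would then exceed
  its supremum.
\<close>

lemma flow_maximum_principle:
  assumes bdd: "bdd_above (G ` E)" and "0 < b"
    and cont: "\<And>\<rho>. \<rho> \<in> E \<Longrightarrow> continuous_on {0..} (\<lambda>t. G (S t \<rho>) :: real)"
  obtains \<rho> \<delta> where "\<rho> \<in> dom" "0 < \<delta>" "(SUP \<rho>\<in>E. G \<rho>) - b \<le> G \<rho>"
    "\<And>t. 0 \<le> t \<Longrightarrow> t \<le> \<delta> \<Longrightarrow> G (S t \<rho>) \<le> G \<rho> + b * t"
proof -
  let ?M = "SUP \<rho>\<in>E. G \<rho>"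
  obtain \<rho>0 where \<rho>0: "\<rho>0 \<in> E" "?M - b < G \<rho>0"
    using less_cSUP_iff[OF E_nonempty bdd, of "?M - b"] \<open>0 < b\<close> by auto
  have "continuous (at 0 within {0..}) (\<lambda>t. G (S t \<rho>0))"
    using cont[OF \<rho>0(1)] by (simp add: continuous_on_eq_continuous_within)
  then have "((\<lambda>t. G (S t \<rho>0)) \<longlongrightarrow> G \<rho>0) (at_right 0)"
    using S_0[OF \<rho>0(1)] by (auto simp: continuous_within intro: tendsto_within_subset)
  then have "\<forall>\<^sub>F t in at_right 0. ?M - b < G (S t \<rho>0)"
    using \<rho>0(2) by (rule order_tendstoD)
  then have "\<forall>\<^sub>F t in at_right 0. ?M - b < G (S t \<rho>0) \<and> 0 < t"
    using eventually_at_right_less[of 0] by (rule eventually_conj)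
  then obtain t0 where t0: "?M - b < G (S t0 \<rho>0)" "0 < t0"
    using eventually_happens trivial_limit_at_right_real by blast
  \<comment> \<open>starting at a positive time makes the energy finite\<close>
  define \<rho>1 where "\<rho>1 = S t0 \<rho>0"
  have \<rho>1: "\<rho>1 \<in> E" "\<rho>1 \<in> dom"
    using S_dom[OF t0(2) \<rho>0(1)] dom_E by (auto simp: \<rho>1_def)
  have "continuous_on {0..1} (\<lambda>s. G (S s \<rho>1) - b * s)"
    by (intro continuous_intros continuous_on_subset[OF cont]) (use \<rho>1 in auto)
  from continuous_attains_sup[OF _ _ this]
  obtain s where s: "s \<in> {0..1}" "\<And>t. t \<in> {0..1} \<Longrightarrow> G (S t \<rho>1) - b * t \<le> G (S s \<rho>1) - b * s"
    by auto
  have s0: "G \<rho>1 \<le> G (S s \<rho>1) - b * s"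
    using s(2)[of 0] S_0[OF \<rho>1(1)] by simp
  have "s \<noteq> 1"
  proof
    assume "s = 1"
    then have "?M < G (S 1 \<rho>1)" using s0 t0(1) by (simp add: \<rho>1_def)
    moreover have "G (S 1 \<rho>1) \<le> ?M"
      by (intro cSUP_upper bdd S_E) (use \<rho>1 in auto)
    ultimately show False by simp
  qed
  show ?thesis
  proof (rule that[of "S s \<rho>1" "1 - s"])
    show "S s \<rho>1 \<in> dom"
      using S_dom[of s \<rho>1] S_0[of \<rho>1] \<rho>1 s(1) by (cases "s = 0") auto
    show "0 < 1 - s" using s(1) \<open>s \<noteq> 1\<close> by simp
    have "0 \<le> b * s" using s(1) \<open>0 < b\<close> by simp
    then show "?M - b \<le> G (S s \<rho>1)" using s0 t0(1) unfolding \<rho>1_def by linarith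
    fix t assume t: "0 \<le> t" "t \<le> 1 - s"
    show "G (S t (S s \<rho>1)) \<le> G (S s \<rho>1) + b * t"
      using s(2)[of "s + t"] S_add[of \<rho>1 t s] \<rho>1 s(1) t by (simp add: algebra_simps)
  qed
qed

subsection \<open>Sup-convolutions and viscosity inequalities\<close>

definition sup_conv :: "real \<Rightarrow> ('e \<Rightarrow> real) \<Rightarrow> 'e \<Rightarrow> real" where
  "sup_conv a w \<rho> = (SUP \<pi>\<in>E. w \<pi> - a / 2 * (d \<pi> \<rho>)\<^sup>2)"

context
  fixes a B :: real and w :: "'e \<Rightarrow> real"
  assumes a: "0 < a" and w: "\<And>\<pi>. \<pi> \<in> E \<Longrightarrow> \<bar>w \<pi>\<bar> \<le> B"
begin

lemma bdd_above_sup_conv: "bdd_above ((\<lambda>\<pi>. w \<pi> - a / 2 * (d \<pi> \<rho>)\<^sup>2) ` E)"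
proof (rule bdd_aboveI2)
  fix \<pi> assume "\<pi> \<in> E"
  moreover have "0 \<le> a / 2 * (d \<pi> \<rho>)\<^sup>2" using a by simp
  ultimately show "w \<pi> - a / 2 * (d \<pi> \<rho>)\<^sup>2 \<le> B" using w[of \<pi>] by linarith
qed

lemma sup_conv_upper: "\<pi> \<in> E \<Longrightarrow> w \<pi> - a / 2 * (d \<pi> \<rho>)\<^sup>2 \<le> sup_conv a w \<rho>"
  unfolding sup_conv_def by (rule cSUP_upper[OF _ bdd_above_sup_conv])

lemma sup_conv_approx:
  assumes "0 < e"
  obtains \<pi> where "\<pi> \<in> E" "sup_conv a w \<rho> - e < w \<pi> - a / 2 * (d \<pi> \<rho>)\<^sup>2"
  using less_cSUP_iff[OF E_nonempty bdd_above_sup_conv[of \<rho>], of "sup_conv a w \<rho> - e"] assms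
  unfolding sup_conv_def by auto

lemma sup_conv_le: "sup_conv a w \<rho> \<le> B"
  unfolding sup_conv_def
proof (rule cSUP_least[OF E_nonempty])
  fix \<pi> assume "\<pi> \<in> E"
  moreover have "0 \<le> a / 2 * (d \<pi> \<rho>)\<^sup>2" using a by simp
  ultimately show "w \<pi> - a / 2 * (d \<pi> \<rho>)\<^sup>2 \<le> B" using w[of \<pi>] by linarith
qed

lemma le_sup_conv: "\<rho> \<in> E \<Longrightarrow> w \<rho> \<le> sup_conv a w \<rho>"
  using sup_conv_upper[of \<rho> \<rho>] d_refl[of \<rho>] by simp

lemma sup_conv_radius:
  assumes "\<rho> \<in> E" "\<pi> \<in> E" "sup_conv a w \<rho> - 1 \<le> w \<pi> - a / 2 * (d \<pi> \<rho>)\<^sup>2"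
  shows "d \<pi> \<rho> \<le> sqrt ((4 * B + 2) / a)"
proof (rule real_le_rsqrt)
  have "a / 2 * (d \<pi> \<rho>)\<^sup>2 \<le> 2 * B + 1"
    using le_sup_conv[OF assms(1)] w[OF assms(1)] w[OF assms(2)] assms(3) by linarith
  then show "(d \<pi> \<rho>)\<^sup>2 \<le> (4 * B + 2) / a"
    using a by (simp add: field_simps)
qed

text \<open>
  Almost optimality in the sup-convolution at \<open>\<rho>'\<close> is inherited at a nearby point \<open>\<rho>\<close>, with a loss that
  does not depend on the optimiser: boundedness of \<open>w\<close> confines all almost optimal points to a
  ball of fixed radius (lemma \<open>sup_conv_radius\<close>), on which the squared distance is Lipschitz.
\<close>

lemma sup_conv_shift:
  assumes "\<rho> \<in> E" "\<rho>' \<in> E" "\<pi> \<in> E" and \<tau>: "d \<rho> \<rho>' \<le> \<tau>" "\<tau> \<le> 1" and e: "e \<le> 1"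
    and opt: "sup_conv a w \<rho>' - e \<le> w \<pi> - a / 2 * (d \<pi> \<rho>')\<^sup>2"
  shows "sup_conv a w \<rho>' - e - a / 2 * (\<tau> * (2 * sqrt ((4 * B + 2) / a) + 1))
      \<le> w \<pi> - a / 2 * (d \<pi> \<rho>)\<^sup>2"
proof -
  have "d \<pi> \<rho>' \<le> sqrt ((4 * B + 2) / a)"
    by (rule sup_conv_radius) (use assms in auto)
  then have "\<bar>(d \<rho> \<pi>)\<^sup>2 - (d \<rho>' \<pi>)\<^sup>2\<bar> \<le> \<tau> * (2 * sqrt ((4 * B + 2) / a) + 1)"
    by (intro d_sq_diff_le) (use assms d_sym in auto)
  then have "(d \<pi> \<rho>)\<^sup>2 \<le> (d \<pi> \<rho>')\<^sup>2 + \<tau> * (2 * sqrt ((4 * B + 2) / a) + 1)"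
    using assms d_sym by auto
  then have "a / 2 * (d \<pi> \<rho>)\<^sup>2 \<le> a / 2 * ((d \<pi> \<rho>')\<^sup>2 + \<tau> * (2 * sqrt ((4 * B + 2) / a) + 1))"
    using a by (intro mult_left_mono) auto
  with opt show ?thesis by (simp add: algebra_simps)
qed

lemma sup_conv_diff:
  assumes "\<rho> \<in> E" "\<rho>' \<in> E" and \<tau>: "d \<rho> \<rho>' \<le> \<tau>" "\<tau> \<le> 1"
  shows "\<bar>sup_conv a w \<rho>' - sup_conv a w \<rho>\<bar> \<le> a / 2 * (\<tau> * (2 * sqrt ((4 * B + 2) / a) + 1))"
proof -
  have *: "sup_conv a w \<rho>' - a / 2 * (\<tau> * (2 * sqrt ((4 * B + 2) / a) + 1)) \<le> sup_conv a w \<rho>"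
    if \<rho>: "\<rho> \<in> E" "\<rho>' \<in> E" "d \<rho> \<rho>' \<le> \<tau>" for \<rho> \<rho>'
  proof (rule field_le_epsilon)
    fix e :: real assume "0 < e"
    obtain \<pi> where \<pi>: "\<pi> \<in> E" "sup_conv a w \<rho>' - min e 1 < w \<pi> - a / 2 * (d \<pi> \<rho>')\<^sup>2"
      using sup_conv_approx[of "min e 1" \<rho>'] \<open>0 < e\<close> by auto
    show "sup_conv a w \<rho>' - a / 2 * (\<tau> * (2 * sqrt ((4 * B + 2) / a) + 1)) \<le> sup_conv a w \<rho> + e"
      using sup_conv_shift[OF \<rho>(1,2) \<pi>(1) \<rho>(3) \<tau>(2), of "min e 1"] \<pi> sup_conv_upper[OF \<pi>(1), of \<rho>]
      by auto
  qed
  have "d \<rho>' \<rho> \<le> \<tau>" using assms d_sym[of \<rho> \<rho>'] by simp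
  with *[OF assms(1-3)] *[OF assms(2,1)] show ?thesis by linarith
qed

lemma sup_conv_cont:
  assumes "x \<in> E" "0 < e"
  shows "\<exists>r>0. \<forall>y\<in>E. d x y < r \<longrightarrow> \<bar>sup_conv a w y - sup_conv a w x\<bar> < e"
proof -
  define K where "K = a / 2 * (2 * sqrt ((4 * B + 2) / a) + 1)"
  have "0 \<le> B" using w[OF assms(1)] by linarith
  then have K: "0 \<le> K" using a by (auto simp: K_def)
  define r where "r = min 1 (e / (K + 1))"
  have "K * r \<le> K * (e / (K + 1))" using K by (intro mult_left_mono) (auto simp: r_def)
  also have "\<dots> < e" using K assms(2) by (simp add: field_simps)
  finally have "K * r < e" .
  moreover have "\<bar>sup_conv a w y - sup_conv a w x\<bar> \<le> K * r" if "y \<in> E" "d x y < r" for y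
    using sup_conv_diff[OF assms(1) that(1), of r] that(2) by (simp add: K_def r_def algebra_simps)
  moreover have "r > 0" using K assms(2) by (auto simp: r_def)
  ultimately show ?thesis by (intro exI[of _ r]) fastforce
qed

end

lemma tataru_nonneg: "0 \<le> tataru d S \<kappa> \<pi> \<rho>"
  unfolding tataru_def by (rule cINF_greatest) (auto simp: d_nonneg)

lemma tataru_refl:
  assumes "\<pi> \<in> E" shows "tataru d S \<kappa> \<pi> \<pi> = 0"
proof (rule antisym[OF _ tataru_nonneg])
  have "tataru d S \<kappa> \<pi> \<pi> \<le> 0 + exp (min 0 \<kappa> * 0) * d \<pi> (S 0 \<pi>)"
    unfolding tataru_def by (rule cINF_lower) (auto intro!: bdd_belowI2[of _ 0] simp: d_nonneg)
  then show "tataru d S \<kappa> \<pi> \<pi> \<le> 0" using S_0[OF assms] d_refl[OF assms] by simp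
qed

text \<open>
  The subsolution property at \<open>\<rho>\<close>, read at one almost optimal point. Centring the Tataru penalisation
  at a point \<open>\<pi>0\<close> that is already almost optimal makes it harmless for arbitrary \<open>b\<close>: it vanishes at
  \<open>\<pi>0\<close> and is nonnegative elsewhere. The points of the test sequence have finite energy because
  \<open>-\<infinity>\<close> for \<open>g\<close> would violate the upper limit condition.
\<close>

lemma subsolution_near_optimal:
  assumes sub: "viscosity_subsolution E d (H_dagger E d en S \<kappa>) lam h u"
    and u: "\<And>\<pi>. \<pi> \<in> E \<Longrightarrow> \<bar>u \<pi>\<bar> \<le> B"
    and pos: "0 < a" "0 < b" "0 < e" "0 < lam" and \<rho>: "\<rho> \<in> dom"
  obtains \<pi> where "\<pi> \<in> dom" "sup_conv a u \<rho> - e \<le> u \<pi> - a / 2 * (d \<pi> \<rho>)\<^sup>2"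
    "u \<pi> - h \<pi> \<le> lam * (a * (real_of_ereal (en \<rho>) - real_of_ereal (en \<pi>)) - a * (\<kappa> / 2) * (d \<pi> \<rho>)\<^sup>2
       + b + a\<^sup>2 / 2 * (d \<pi> \<rho>)\<^sup>2 + a * b * d \<pi> \<rho> + b\<^sup>2 / 2) + e"
proof -
  obtain \<pi>0 where \<pi>0: "\<pi>0 \<in> E" "sup_conv a u \<rho> - e / 2 < u \<pi>0 - a / 2 * (d \<pi>0 \<rho>)\<^sup>2"
    using sup_conv_approx[where w = u and B = B and e = "e / 2" and \<rho> = \<rho>, OF pos(1) u half_gt_zero[OF pos(3)]] by blast
  define f where "f = (\<lambda>\<pi>. 1/2 * a * (d \<pi> \<rho>)\<^sup>2 + b * tataru d S \<kappa> \<pi> \<pi>0 + 0)"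
  define g0 where "g0 = (\<lambda>\<pi>. - a * (\<kappa> / 2) * (d \<pi> \<rho>)\<^sup>2 + b
                     + 1/2 * a\<^sup>2 * (d \<pi> \<rho>)\<^sup>2 + a * b * d \<pi> \<rho> + 1/2 * b\<^sup>2)"
  define g where "g = (\<lambda>\<pi>. ereal a * (en \<rho> - en \<pi>) + ereal (g0 \<pi>))"
  have "(f, g) \<in> H_dagger E d en S \<kappa>"
    unfolding H_dagger_def f_def g_def g0_def using pos \<rho> \<pi>0(1) dom_E[OF \<rho>]
    by (intro CollectI exI[of _ a] exI[of _ b] exI[of _ 0] exI[of _ \<pi>0] exI[of _ \<rho>])
       (auto simp: energy_dom_def)
  with sub obtain p :: "nat \<Rightarrow> 'e" where p: "\<And>n. p n \<in> E"
    "(\<lambda>n. u (p n) - f (p n)) \<longlonglongrightarrow> (SUP \<pi>\<in>E. u \<pi> - f \<pi>)"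
    "limsup (\<lambda>n. ereal (u (p n)) - ereal lam * g (p n) - ereal (h (p n))) \<le> 0"
    unfolding viscosity_subsolution_def by blast
  have f_ge: "a / 2 * (d \<pi> \<rho>)\<^sup>2 \<le> f \<pi>" for \<pi>
    using tataru_nonneg[of \<pi> \<pi>0] pos by (simp add: f_def)
  have "u \<pi>0 - f \<pi>0 \<le> (SUP \<pi>\<in>E. u \<pi> - f \<pi>)"
  proof (rule cSUP_upper[OF \<pi>0(1)], rule bdd_aboveI2)
    fix \<pi> assume "\<pi> \<in> E"
    moreover have "0 \<le> a / 2 * (d \<pi> \<rho>)\<^sup>2" using pos by simp
    ultimately show "u \<pi> - f \<pi> \<le> B" using u[of \<pi>] f_ge[of \<pi>] by linarith
  qed
  moreover have "u \<pi>0 - f \<pi>0 = u \<pi>0 - a / 2 * (d \<pi>0 \<rho>)\<^sup>2"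
    using tataru_refl[OF \<pi>0(1)] by (simp add: f_def)
  ultimately have "sup_conv a u \<rho> - e < (SUP \<pi>\<in>E. u \<pi> - f \<pi>)"
    using \<pi>0(2) pos(3) by linarith
  with p(2) have "\<forall>\<^sub>F n in sequentially. sup_conv a u \<rho> - e < u (p n) - f (p n)"
    by (rule order_tendstoD)
  moreover have "\<forall>\<^sub>F n in sequentially. ereal (u (p n)) - ereal lam * g (p n) - ereal (h (p n)) < ereal e"
    by (rule Limsup_lessD) (use p(3) pos(3) in \<open>auto intro: le_less_trans\<close>)
  ultimately have "\<forall>\<^sub>F n in sequentially. sup_conv a u \<rho> - e < u (p n) - f (p n)
      \<and> ereal (u (p n)) - ereal lam * g (p n) - ereal (h (p n)) < ereal e"
    by (rule eventually_conj)
  then obtain n where n: "sup_conv a u \<rho> - e < u (p n) - f (p n)"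
    "ereal (u (p n)) - ereal lam * g (p n) - ereal (h (p n)) < ereal e"
    using eventually_happens trivial_limit_sequentially by blast
  have "en (p n) \<noteq> \<infinity>"
  proof
    assume "en (p n) = \<infinity>"
    then have "en \<rho> - en (p n) = -\<infinity>" by (subst dom_ereal[OF \<rho>]) simp
    then have "g (p n) = -\<infinity>" using pos(1) by (simp add: g_def)
    with n(2) pos(4) show False by simp
  qed
  then have dom: "p n \<in> dom" using p(1) by (auto simp: energy_dom_def)
  have "g (p n) = ereal (a * (real_of_ereal (en \<rho>) - real_of_ereal (en (p n))) + g0 (p n))"
    unfolding g_def by (subst dom_ereal[OF dom], subst dom_ereal[OF \<rho>]) simp
  then have "u (p n) - lam * (a * (real_of_ereal (en \<rho>) - real_of_ereal (en (p n))) + g0 (p n)) - h (p n) < e"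
    using n(2) by simp
  moreover have "sup_conv a u \<rho> - e \<le> u (p n) - a / 2 * (d (p n) \<rho>)\<^sup>2"
    using n(1) f_ge[of "p n"] by linarith
  ultimately show ?thesis
    by (intro that[OF dom]) (auto simp: g0_def algebra_simps)
qed

text \<open>
  The mirror image for supersolutions; \<open>v\<close> enters through the sup-convolution of \<open>- v\<close>.
\<close>

lemma supersolution_near_optimal:
  assumes super: "viscosity_supersolution E d (H_ddagger E d en S \<kappa>) lam h v"
    and v: "\<And>\<pi>. \<pi> \<in> E \<Longrightarrow> \<bar>v \<pi>\<bar> \<le> B"
    and pos: "0 < a" "0 < b" "0 < e" "0 < lam" and \<rho>: "\<rho> \<in> dom"
  obtains \<pi> where "\<pi> \<in> dom" "sup_conv a (\<lambda>\<pi>. - v \<pi>) \<rho> - e \<le> - v \<pi> - a / 2 * (d \<pi> \<rho>)\<^sup>2"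
    "lam * (a * (real_of_ereal (en \<pi>) - real_of_ereal (en \<rho>)) + a * (\<kappa> / 2) * (d \<pi> \<rho>)\<^sup>2
       - b + a\<^sup>2 / 2 * (d \<pi> \<rho>)\<^sup>2 - a * b * d \<pi> \<rho> - b\<^sup>2 / 2) - e \<le> v \<pi> - h \<pi>"
proof -
  have v': "\<bar>- v \<pi>\<bar> \<le> B" if "\<pi> \<in> E" for \<pi> using v[OF that] by simp
  obtain \<pi>0 where \<pi>0: "\<pi>0 \<in> E" "sup_conv a (\<lambda>\<pi>. - v \<pi>) \<rho> - e / 2 < - v \<pi>0 - a / 2 * (d \<pi>0 \<rho>)\<^sup>2"
    using sup_conv_approx[where w = "\<lambda>\<pi>. - v \<pi>" and B = B and e = "e / 2" and \<rho> = \<rho>, OF pos(1) v' half_gt_zero[OF pos(3)]] by blast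
  define f where "f = (\<lambda>\<pi>. - 1/2 * a * (d \<rho> \<pi>)\<^sup>2 - b * tataru d S \<kappa> \<pi> \<pi>0 + 0)"
  define g0 where "g0 = (\<lambda>\<pi>. a * (\<kappa> / 2) * (d \<rho> \<pi>)\<^sup>2 - b
                     + 1/2 * a\<^sup>2 * (d \<rho> \<pi>)\<^sup>2 - a * b * d \<rho> \<pi> - 1/2 * b\<^sup>2)"
  define g where "g = (\<lambda>\<pi>. ereal a * (en \<pi> - en \<rho>) + ereal (g0 \<pi>))"
  have "(f, g) \<in> H_ddagger E d en S \<kappa>"
    unfolding H_ddagger_def f_def g_def g0_def using pos \<rho> \<pi>0(1) dom_E[OF \<rho>]
    by (intro CollectI exI[of _ a] exI[of _ b] exI[of _ 0] exI[of _ \<pi>0] exI[of _ \<rho>])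
       (auto simp: energy_dom_def)
  with super obtain p :: "nat \<Rightarrow> 'e" where p: "\<And>n. p n \<in> E"
    "(\<lambda>n. v (p n) - f (p n)) \<longlonglongrightarrow> (INF \<pi>\<in>E. v \<pi> - f \<pi>)"
    "liminf (\<lambda>n. ereal (v (p n)) - ereal lam * g (p n) - ereal (h (p n))) \<ge> 0"
    unfolding viscosity_supersolution_def by blast
  have f_le: "f \<pi> \<le> - (a / 2 * (d \<rho> \<pi>)\<^sup>2)" for \<pi>
    using tataru_nonneg[of \<pi> \<pi>0] pos by (simp add: f_def)
  have "(INF \<pi>\<in>E. v \<pi> - f \<pi>) \<le> v \<pi>0 - f \<pi>0"
  proof (rule cINF_lower[OF _ \<pi>0(1)], rule bdd_belowI2)
    fix \<pi> assume "\<pi> \<in> E"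
    moreover have "0 \<le> a / 2 * (d \<rho> \<pi>)\<^sup>2" using pos by simp
    ultimately show "- B \<le> v \<pi> - f \<pi>" using v[of \<pi>] f_le[of \<pi>] by linarith
  qed
  moreover have "v \<pi>0 - f \<pi>0 = v \<pi>0 + a / 2 * (d \<pi>0 \<rho>)\<^sup>2"
    using tataru_refl[OF \<pi>0(1)] d_sym[OF \<pi>0(1) dom_E[OF \<rho>]] by (simp add: f_def)
  ultimately have "(INF \<pi>\<in>E. v \<pi> - f \<pi>) < - (sup_conv a (\<lambda>\<pi>. - v \<pi>) \<rho> - e)"
    using \<pi>0(2) pos(3) by linarith
  with p(2) have "\<forall>\<^sub>F n in sequentially. v (p n) - f (p n) < - (sup_conv a (\<lambda>\<pi>. - v \<pi>) \<rho> - e)"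
    by (rule order_tendstoD)
  moreover have "\<forall>\<^sub>F n in sequentially. ereal (- e) < ereal (v (p n)) - ereal lam * g (p n) - ereal (h (p n))"
    by (rule less_LiminfD) (use less_le_trans[OF _ p(3), of "ereal (- e)"] pos(3) in simp)
  ultimately have "\<forall>\<^sub>F n in sequentially. v (p n) - f (p n) < - (sup_conv a (\<lambda>\<pi>. - v \<pi>) \<rho> - e)
      \<and> ereal (- e) < ereal (v (p n)) - ereal lam * g (p n) - ereal (h (p n))"
    by (rule eventually_conj)
  then obtain n where n: "v (p n) - f (p n) < - (sup_conv a (\<lambda>\<pi>. - v \<pi>) \<rho> - e)"
    "ereal (- e) < ereal (v (p n)) - ereal lam * g (p n) - ereal (h (p n))"
    using eventually_happens trivial_limit_sequentially by blast
  have "en (p n) \<noteq> \<infinity>"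
  proof
    assume "en (p n) = \<infinity>"
    then have "en (p n) - en \<rho> = \<infinity>" by (subst dom_ereal[OF \<rho>]) simp
    then have "g (p n) = \<infinity>" using pos(1) by (simp add: g_def)
    with n(2) pos(4) show False by simp
  qed
  then have dom: "p n \<in> dom" using p(1) by (auto simp: energy_dom_def)
  have "g (p n) = ereal (a * (real_of_ereal (en (p n)) - real_of_ereal (en \<rho>)) + g0 (p n))"
    unfolding g_def by (subst dom_ereal[OF dom], subst dom_ereal[OF \<rho>]) simp
  then have "- e < v (p n) - lam * (a * (real_of_ereal (en (p n)) - real_of_ereal (en \<rho>)) + g0 (p n)) - h (p n)"
    using n(2) by simp
  moreover have "sup_conv a (\<lambda>\<pi>. - v \<pi>) \<rho> - e \<le> - v (p n) - a / 2 * (d \<rho> (p n))\<^sup>2"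
    using n(1) f_le[of "p n"] by linarith
  ultimately show ?thesis
    using d_sym[OF p(1) dom_E[OF \<rho>], of n]
    by (intro that[OF dom]) (auto simp: g0_def algebra_simps)
qed

subsection \<open>Doubling of variables\<close>

text \<open>
  The supremum of \<open>u \<pi> - v \<mu> - a/2 (d(\<pi>,\<rho>)\<^sup>2 + d(\<mu>,\<rho>)\<^sup>2)\<close> over all three points. The usual doubling of
  variables compares \<open>\<pi>\<close> with \<open>\<mu>\<close> directly; the third point \<open>\<rho>\<close> is there because both Hamiltonians
  require a centre of finite energy.
\<close>

definition doubled_sup :: "('e \<Rightarrow> real) \<Rightarrow> ('e \<Rightarrow> real) \<Rightarrow> real \<Rightarrow> real" where
  "doubled_sup u v a = (SUP \<rho>\<in>E. sup_conv a u \<rho> + sup_conv a (\<lambda>\<pi>. - v \<pi>) \<rho>)"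

context
  fixes u v :: "'e \<Rightarrow> real" and B :: real
  assumes u: "\<And>\<pi>. \<pi> \<in> E \<Longrightarrow> \<bar>u \<pi>\<bar> \<le> B"
    and v: "\<And>\<pi>. \<pi> \<in> E \<Longrightarrow> \<bar>v \<pi>\<bar> \<le> B"
begin

lemma minus_v: "\<pi> \<in> E \<Longrightarrow> \<bar>- v \<pi>\<bar> \<le> B"
  using v by simp

lemma bdd_above_doubled:
  "0 < a \<Longrightarrow> bdd_above ((\<lambda>\<rho>. sup_conv a u \<rho> + sup_conv a (\<lambda>\<pi>. - v \<pi>) \<rho>) ` E)"
  using sup_conv_le[where w = u, OF _ u] sup_conv_le[where w = "\<lambda>\<pi>. - v \<pi>", OF _ minus_v] by (intro bdd_aboveI2[of _ _ "B + B"] add_mono) auto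

lemma doubled_sup_upper:
  assumes "0 < a" "\<pi> \<in> E" "\<mu> \<in> E" "\<rho> \<in> E"
  shows "u \<pi> - v \<mu> - a / 2 * ((d \<pi> \<rho>)\<^sup>2 + (d \<mu> \<rho>)\<^sup>2) \<le> doubled_sup u v a"
proof -
  have "u \<pi> - v \<mu> - a / 2 * ((d \<pi> \<rho>)\<^sup>2 + (d \<mu> \<rho>)\<^sup>2)
      = (u \<pi> - a / 2 * (d \<pi> \<rho>)\<^sup>2) + (- v \<mu> - a / 2 * (d \<mu> \<rho>)\<^sup>2)"
    by (simp add: algebra_simps)
  also have "\<dots> \<le> sup_conv a u \<rho> + sup_conv a (\<lambda>\<pi>. - v \<pi>) \<rho>"
    using sup_conv_upper[where w = u, OF assms(1) u assms(2)] sup_conv_upper[where w = "\<lambda>\<pi>. - v \<pi>", OF assms(1) minus_v assms(3)]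
    by (intro add_mono) auto
  also have "\<dots> \<le> doubled_sup u v a"
    unfolding doubled_sup_def by (intro cSUP_upper bdd_above_doubled assms)
  finally show ?thesis .
qed

lemma difference_le_doubled_sup:
  assumes "0 < a" "\<pi> \<in> E" shows "u \<pi> - v \<pi> \<le> doubled_sup u v a"
  using doubled_sup_upper[OF assms(1,2,2,2)] d_refl[OF assms(2)] by simp

text \<open>
  Placing \<open>\<rho>\<close> at an approximate midpoint of \<open>\<pi>\<close> and \<open>\<mu>\<close> shows that the penalty \<open>a/4 d(\<pi>,\<mu>)\<^sup>2\<close> gives
  no larger supremum. For an almost optimal triple this forces \<open>\<rho>\<close> to be almost equidistant from \<open>\<pi>\<close> and \<open>\<mu>\<close>.
\<close>

lemma doubled_sup_midpoint:
  assumes "0 < a" "\<pi> \<in> E" "\<mu> \<in> E"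
  shows "u \<pi> - v \<mu> - a / 4 * (d \<pi> \<mu>)\<^sup>2 \<le> doubled_sup u v a"
proof (rule tendsto_upperbound)
  have *: "u \<pi> - v \<mu> - a * (d \<pi> \<mu> / 2 + s)\<^sup>2 \<le> doubled_sup u v a" if "0 < s" for s
  proof -
    obtain m where m: "m \<in> E" "d \<pi> m \<le> d \<pi> \<mu> / 2 + s" "d \<mu> m \<le> d \<pi> \<mu> / 2 + s"
      using midpoint[OF assms(2,3) \<open>0 < s\<close>] by auto
    have "(d \<pi> m)\<^sup>2 + (d \<mu> m)\<^sup>2 \<le> (d \<pi> \<mu> / 2 + s)\<^sup>2 + (d \<pi> \<mu> / 2 + s)\<^sup>2"
      using m d_nonneg by (intro add_mono power_mono) auto
    then have "a / 2 * ((d \<pi> m)\<^sup>2 + (d \<mu> m)\<^sup>2) \<le> a / 2 * ((d \<pi> \<mu> / 2 + s)\<^sup>2 + (d \<pi> \<mu> / 2 + s)\<^sup>2)"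
      using assms(1) by (intro mult_left_mono) auto
    with doubled_sup_upper[OF assms m(1)] show ?thesis by simp
  qed
  show "\<forall>\<^sub>F s in at_right 0. u \<pi> - v \<mu> - a * (d \<pi> \<mu> / 2 + s)\<^sup>2 \<le> doubled_sup u v a"
    using eventually_at_right_less[of 0] by (rule eventually_mono) (use * in auto)
  have "((\<lambda>s. u \<pi> - v \<mu> - a * (d \<pi> \<mu> / 2 + s)\<^sup>2) \<longlongrightarrow> u \<pi> - v \<mu> - a * (d \<pi> \<mu> / 2 + 0)\<^sup>2) (at_right 0)"
    by (intro tendsto_intros)
  then show "((\<lambda>s. u \<pi> - v \<mu> - a * (d \<pi> \<mu> / 2 + s)\<^sup>2) \<longlongrightarrow> u \<pi> - v \<mu> - a / 4 * (d \<pi> \<mu>)\<^sup>2) (at_right 0)"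
    by (simp add: power_divide)
qed simp

text \<open>
  Everything is evaluated at an almost optimal triple. Subtracting the two viscosity inequalities
  leaves three kinds of terms. The energies enter as \<open>a (2 E(\<rho>) - E(\<pi>) - E(\<mu>))\<close>; since \<open>\<rho>\<close> is almost
  optimal, moving it along the flow cannot decrease the sum of its squared distances to \<open>\<pi>\<close> and \<open>\<mu>\<close> much,
  and the EVI turns this into an upper bound for that combination. The quadratic terms of
  the Hamiltonians cancel up to \<open>a\<^sup>2/2 (d(\<pi>,\<rho>)\<^sup>2 - d(\<mu>,\<rho>)\<^sup>2)\<close>, which is small by the midpoint property.
  Apart from \<open>h1 \<pi> - h2 \<mu>\<close>, what does not vanish with \<open>b\<close> is a multiple of \<open>\<bar>\<kappa>\<bar> a (d(\<pi>,\<rho>)\<^sup>2 + d(\<mu>,\<rho>)\<^sup>2)\<close>.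

  Two centres play the role of \<open>\<rho>\<close> in the proof. The flow is started at \<open>\<rho>\<close>, whose energy may exceed
  the lower limit \<open>l\<close> along the flow; the viscosity inequalities are used at \<open>\<rho>'\<close>, a point of the
  same trajectory that lies very close to \<open>\<rho>\<close> and has energy almost \<open>l\<close>. The order of the choices is
  essential: first the time \<open>T\<close> of the comparison along the flow, then the distance \<open>\<tau>\<close> between the
  centres and the tolerance \<open>e\<close>, both small compared with \<open>b * T\<close>, and only then \<open>\<pi>\<close> and \<open>\<mu>\<close>.
\<close>

lemma doubling_estimate:
  assumes sub: "viscosity_subsolution E d (H_dagger E d en S \<kappa>) lam h1 u"
    and super: "viscosity_supersolution E d (H_ddagger E d en S \<kappa>) lam h2 v"
    and a: "0 < a" and b: "0 < b" and lam: "0 < lam"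
  defines "R \<equiv> sqrt ((4 * B + 2) / a)"
  obtains \<pi> \<mu> \<rho> where "\<pi> \<in> E" "\<mu> \<in> E" "\<rho> \<in> E"
    "doubled_sup u v a - 2 * b \<le> u \<pi> - v \<mu> - a / 2 * ((d \<pi> \<rho>)\<^sup>2 + (d \<mu> \<rho>)\<^sup>2)"
    "u \<pi> - v \<mu> \<le> h1 \<pi> - h2 \<mu> + lam * (\<bar>\<kappa>\<bar> * (a * ((d \<pi> \<rho>)\<^sup>2 + (d \<mu> \<rho>)\<^sup>2))
        + 4 * b + 6 * a * b + a\<^sup>2 * R * sqrt (8 * b / a) + 2 * a * b * R + b\<^sup>2) + 2 * b"
proof -
  define U where "U = sup_conv a u"
  define V where "V = sup_conv a (\<lambda>\<pi>. - v \<pi>)"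
  define M where "M = doubled_sup u v a"
  define G where "G = (\<lambda>\<rho>. U \<rho> + V \<rho>)"
  define K where "K = 2 * R + 1"
  have "0 \<le> B" using u E_nonempty by fastforce
  then have R: "0 \<le> R" unfolding R_def using a by simp
  then have K: "1 \<le> K" by (simp add: K_def)
  have contG: "continuous_on {0..} (\<lambda>t. G (S t \<rho>))" if "\<rho> \<in> E" for \<rho>
    unfolding G_def U_def V_def
    by (intro continuous_on_add continuous_on_flow[OF that] sup_conv_cont[where w = u, OF a u] sup_conv_cont[where w = "\<lambda>\<pi>. - v \<pi>", OF a minus_v])
  have bddG: "bdd_above (G ` E)"
    unfolding G_def U_def V_def by (rule bdd_above_doubled[OF a])
  have M_eq: "M = (SUP \<rho>\<in>E. G \<rho>)"
    unfolding M_def doubled_sup_def G_def U_def V_def ..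
  obtain \<rho> \<delta> where \<rho>: "\<rho> \<in> dom" "0 < \<delta>" "M - b \<le> G \<rho>"
    "\<And>t. 0 \<le> t \<Longrightarrow> t \<le> \<delta> \<Longrightarrow> G (S t \<rho>) \<le> G \<rho> + b * t"
    using flow_maximum_principle[OF bddG b contG] unfolding M_eq by blast
  note \<rho>E = dom_E[OF \<rho>(1)]
  obtain l where l: "\<And>\<eta>. 0 < \<eta> \<Longrightarrow> \<forall>\<^sub>F t in at_right 0. ereal (l - \<eta>) \<le> en (S t \<rho>)"
    "\<And>\<eta>. 0 < \<eta> \<Longrightarrow> \<exists>\<^sub>F t in at_right 0. en (S t \<rho>) < ereal (l + \<eta>)"
    using flow_start_energy[OF \<rho>(1)] by blast
  note near = flow_near_start[OF \<rho>E]
  \<comment> \<open>\<open>\<sigma>\<close> bounds the excursion of the flow from \<open>\<rho>\<close> up to time \<open>T\<close>; it is chosen so that the curvature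
    term changes by at most \<open>b\<close>\<close>
  define \<sigma> where "\<sigma> = min (1 / 2) (b / ((1 + \<bar>\<kappa>\<bar>) * K))"
  have "\<sigma> \<le> 1 / 2" unfolding \<sigma>_def by (rule min.cobounded1)
  moreover have "0 < \<sigma>" using b K by (auto simp: \<sigma>_def)
  ultimately have \<sigma>: "0 < \<sigma>" "\<sigma> \<le> 1 / 2" by auto
  have "\<sigma> * ((1 + \<bar>\<kappa>\<bar>) * K) \<le> b / ((1 + \<bar>\<kappa>\<bar>) * K) * ((1 + \<bar>\<kappa>\<bar>) * K)"
    using K by (intro mult_right_mono) (auto simp: \<sigma>_def)
  also have "\<dots> = b" using K by simp
  finally have \<sigma>K: "(1 + \<bar>\<kappa>\<bar>) * (\<sigma> * K) \<le> b" by (simp add: mult_ac)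
  have "0 \<le> \<sigma> * K" using \<sigma> K by simp
  then have \<kappa>\<sigma>: "\<bar>\<kappa>\<bar> * (\<sigma> * K) \<le> b" using \<sigma>K by (simp add: algebra_simps)
  have "\<forall>\<^sub>F t in at_right 0. ereal (l - b) \<le> en (S t \<rho>) \<and> d \<rho> (S t \<rho>) < \<sigma>"
    by (rule eventually_conj[OF l(1)[OF b] near[OF \<sigma>(1)]])
  then obtain T0 where T0: "T0 > 0"
    "\<And>t. 0 < t \<Longrightarrow> t < T0 \<Longrightarrow> ereal (l - b) \<le> en (S t \<rho>) \<and> d \<rho> (S t \<rho>) < \<sigma>"
    unfolding eventually_at_right_field by auto
  define T where "T = min 1 (min \<delta> T0)"
  have T: "0 < T" "T \<le> 1" "T \<le> \<delta>" "T \<le> T0" using \<rho>(2) T0(1) by (auto simp: T_def)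
  \<comment> \<open>\<open>\<tau>\<close> is chosen so that passing from \<open>\<rho>\<close> to \<open>\<rho>'\<close> costs little compared with \<open>b * T\<close>\<close>
  define \<tau> where "\<tau> = min \<sigma> (b * T / (4 * a * K))"
  have \<tau>: "0 < \<tau>" "\<tau> \<le> \<sigma>" using \<sigma> b T a K by (auto simp: \<tau>_def)
  have "a * (\<tau> * K) \<le> a * (b * T / (4 * a * K) * K)"
    using a K by (intro mult_left_mono mult_right_mono) (auto simp: \<tau>_def)
  also have "\<dots> = b * T / 4" using a K by (simp add: field_simps)
  finally have a\<tau>: "a * (\<tau> * K) \<le> b * T / 4" .
  have "\<exists>\<^sub>F t in at_right 0. en (S t \<rho>) < ereal (l + b) \<and> (d \<rho> (S t \<rho>) < \<tau> \<and> t \<in> {0<..<T})"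
    using near[OF \<tau>(1)] eventually_at_right_real[OF T(1)]
    by (intro frequently_eventually_frequently[OF l(2)[OF b]] eventually_conj)
  then obtain r where r: "en (S r \<rho>) < ereal (l + b)" "d \<rho> (S r \<rho>) < \<tau>" "0 < r" "r < T"
    by (metis (mono_tags, lifting) frequently_ex greaterThanLessThan_iff)
  define \<rho>' where "\<rho>' = S r \<rho>"
  have \<rho>': "\<rho>' \<in> dom" "\<rho>' \<in> E"
    using S_dom[OF r(3) \<rho>E] dom_E by (auto simp: \<rho>'_def)
  define e where "e = min 1 (b * T / 4)"
  have e: "0 < e" "e \<le> 1" "e \<le> b * T / 4" using b T by (auto simp: e_def)
  define E0 where "E0 = real_of_ereal (en \<rho>')"
  obtain \<pi> where \<pi>: "\<pi> \<in> dom" "U \<rho>' - e \<le> u \<pi> - a / 2 * (d \<pi> \<rho>')\<^sup>2"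
    "u \<pi> - h1 \<pi> \<le> lam * (a * (E0 - real_of_ereal (en \<pi>)) - a * (\<kappa> / 2) * (d \<pi> \<rho>')\<^sup>2
       + b + a\<^sup>2 / 2 * (d \<pi> \<rho>')\<^sup>2 + a * b * d \<pi> \<rho>' + b\<^sup>2 / 2) + e"
    using subsolution_near_optimal[OF sub u a b e(1) lam \<rho>'(1)] unfolding U_def E0_def by blast
  obtain \<mu> where \<mu>: "\<mu> \<in> dom" "V \<rho>' - e \<le> - v \<mu> - a / 2 * (d \<mu> \<rho>')\<^sup>2"
    "lam * (a * (real_of_ereal (en \<mu>) - E0) + a * (\<kappa> / 2) * (d \<mu> \<rho>')\<^sup>2
       - b + a\<^sup>2 / 2 * (d \<mu> \<rho>')\<^sup>2 - a * b * d \<mu> \<rho>' - b\<^sup>2 / 2) - e \<le> v \<mu> - h2 \<mu>"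
    using supersolution_near_optimal[OF super v a b e(1) lam \<rho>'(1)] unfolding V_def E0_def by blast
  define E1 where "E1 = real_of_ereal (en \<pi>)"
  define E2 where "E2 = real_of_ereal (en \<mu>)"
  define D1 where "D1 = d \<pi> \<rho>'"
  define D2 where "D2 = d \<mu> \<rho>'"
  note \<pi>E = dom_E[OF \<pi>(1)] and \<mu>E = dom_E[OF \<mu>(1)]
  have D1: "0 \<le> D1" "D1 \<le> R"
    unfolding D1_def R_def using \<pi>(2) e(2) d_nonneg
    by (auto intro!: sup_conv_radius[where w = u, OF a u \<rho>'(2) \<pi>E] simp: U_def)
  have D2: "0 \<le> D2" "D2 \<le> R"
    unfolding D2_def R_def using \<mu>(2) e(2) d_nonneg
    by (auto intro!: sup_conv_radius[where w = "\<lambda>\<pi>. - v \<pi>", OF a minus_v \<rho>'(2) \<mu>E] simp: V_def)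
  \<comment> \<open>the EVI on \<open>{0..T}\<close>, with the distances along the curve frozen at \<open>\<rho>'\<close>\<close>
  have evi: "(d (S T \<rho>) \<omega>)\<^sup>2 / 2 - (d \<rho> \<omega>)\<^sup>2 / 2
      \<le> (real_of_ereal (en \<omega>) - (l - b) - (\<kappa> / 2 * (d \<omega> \<rho>')\<^sup>2 - b)) * T"
    if \<omega>: "\<omega> \<in> dom" and D: "d \<omega> \<rho>' \<le> R" for \<omega>
  proof (rule EVI_integrated[OF \<rho>E \<omega> T(1)])
    fix s assume s: "0 < s" "s < T"
    note sT = T0(2)[OF s(1)]
    show "ereal (l - b) \<le> en (S s \<rho>)" using sT s T by simp
    have sE: "S s \<rho> \<in> E" using S_E s \<rho>E by simp
    have "d \<rho>' (S s \<rho>) \<le> d \<rho> \<rho>' + d \<rho> (S s \<rho>)"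
      using d_tri[OF \<rho>'(2) \<rho>E sE] d_sym[OF \<rho>'(2) \<rho>E] by simp
    also have "\<dots> \<le> 2 * \<sigma>" using sT s T r(2) \<tau>(2) by (simp add: \<rho>'_def)
    finally have "\<bar>(d (S s \<rho>) \<omega>)\<^sup>2 - (d \<rho>' \<omega>)\<^sup>2\<bar> \<le> (2 * \<sigma>) * (2 * R + 1)"
      using d_sq_diff_le[OF \<rho>'(2) sE dom_E[OF \<omega>], of R "2 * \<sigma>"] D d_sym[OF \<rho>'(2) dom_E[OF \<omega>]] \<sigma>(2)
      by simp
    then have "\<bar>\<kappa>\<bar> * \<bar>(d (S s \<rho>) \<omega>)\<^sup>2 - (d \<rho>' \<omega>)\<^sup>2\<bar> \<le> \<bar>\<kappa>\<bar> * ((2 * \<sigma>) * K)"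
      by (intro mult_left_mono) (auto simp: K_def)
    also have "\<dots> \<le> 2 * b" using \<kappa>\<sigma> by (simp add: mult_ac)
    finally have "\<bar>\<kappa> * ((d (S s \<rho>) \<omega>)\<^sup>2 - (d \<rho>' \<omega>)\<^sup>2)\<bar> \<le> 2 * b"
      by (simp add: abs_mult)
    then have "\<kappa> * (d \<rho>' \<omega>)\<^sup>2 - 2 * b \<le> \<kappa> * (d (S s \<rho>) \<omega>)\<^sup>2"
      unfolding right_diff_distrib by linarith
    then show "\<kappa> / 2 * (d \<omega> \<rho>')\<^sup>2 - b \<le> \<kappa> / 2 * (d (S s \<rho>) \<omega>)\<^sup>2"
      using d_sym[OF \<rho>'(2) dom_E[OF \<omega>]] by simp
  qed
  have evi1: "(d (S T \<rho>) \<pi>)\<^sup>2 / 2 - (d \<rho> \<pi>)\<^sup>2 / 2 \<le> (E1 - l + 2 * b - \<kappa> / 2 * D1\<^sup>2) * T"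
    using evi[OF \<pi>(1)] D1(2) by (simp add: D1_def E1_def algebra_simps)
  have evi2: "(d (S T \<rho>) \<mu>)\<^sup>2 / 2 - (d \<rho> \<mu>)\<^sup>2 / 2 \<le> (E2 - l + 2 * b - \<kappa> / 2 * D2\<^sup>2) * T"
    using evi[OF \<mu>(1)] D2(2) by (simp add: D2_def E2_def algebra_simps)
  \<comment> \<open>\<open>\<pi>\<close> and \<open>\<mu>\<close>, chosen for \<open>\<rho>'\<close>, are almost optimal for \<open>\<rho>\<close> too, so the growth bound on \<open>G\<close> along the
    flow becomes a lower bound on the growth of the squared distances\<close>
  define k where "k = a / 2 * (\<tau> * K)"
  have "k = (a * (\<tau> * K)) / 2" by (simp add: k_def)
  then have "k \<le> b * T / 8" using a\<tau> by linarith
  moreover have "0 \<le> k" using a K \<tau>(1) by (simp add: k_def)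
  ultimately have k: "k \<le> b * T / 8" "0 \<le> k" .
  have \<tau>': "d \<rho> \<rho>' \<le> \<tau>" "\<tau> \<le> 1" using r(2) \<tau> \<sigma> by (auto simp: \<rho>'_def)
  have U1: "U \<rho>' - e - k \<le> u \<pi> - a / 2 * (d \<pi> \<rho>)\<^sup>2"
    using sup_conv_shift[where w = u, OF a u \<rho>E \<rho>'(2) \<pi>E \<tau>' e(2)] \<pi>(2) unfolding U_def k_def K_def R_def by blast
  have V1: "V \<rho>' - e - k \<le> - v \<mu> - a / 2 * (d \<mu> \<rho>)\<^sup>2"
    using sup_conv_shift[where w = "\<lambda>\<pi>. - v \<pi>", OF a minus_v \<rho>E \<rho>'(2) \<mu>E \<tau>' e(2)] \<mu>(2) unfolding V_def k_def K_def R_def by blast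
  have U2: "\<bar>U \<rho>' - U \<rho>\<bar> \<le> k"
    using sup_conv_diff[where w = u, OF a u \<rho>E \<rho>'(2) \<tau>'] unfolding U_def k_def K_def R_def by blast
  have V2: "\<bar>V \<rho>' - V \<rho>\<bar> \<le> k"
    using sup_conv_diff[where w = "\<lambda>\<pi>. - v \<pi>", OF a minus_v \<rho>E \<rho>'(2) \<tau>'] unfolding V_def k_def K_def R_def by blast
  have STE: "S T \<rho> \<in> E" using S_E T \<rho>E by simp
  have U3: "u \<pi> - a / 2 * (d (S T \<rho>) \<pi>)\<^sup>2 \<le> U (S T \<rho>)"
    using sup_conv_upper[where w = u and \<rho> = "S T \<rho>", OF a u \<pi>E] d_sym[OF STE \<pi>E] unfolding U_def by simp
  have V3: "- v \<mu> - a / 2 * (d (S T \<rho>) \<mu>)\<^sup>2 \<le> V (S T \<rho>)"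
    using sup_conv_upper[where w = "\<lambda>\<pi>. - v \<pi>" and \<rho> = "S T \<rho>", OF a minus_v \<mu>E] d_sym[OF STE \<mu>E] unfolding V_def by simp
  have G3: "U (S T \<rho>) + V (S T \<rho>) \<le> U \<rho> + V \<rho> + b * T"
    using \<rho>(4)[of T] T by (simp add: G_def)
  have "a / 2 * (d \<rho> \<pi>)\<^sup>2 + a / 2 * (d \<rho> \<mu>)\<^sup>2 \<le> a / 2 * (d (S T \<rho>) \<pi>)\<^sup>2 + a / 2 * (d (S T \<rho>) \<mu>)\<^sup>2 + 2 * e + 4 * k + b * T"
    using U1 V1 U2 V2 U3 V3 G3 d_sym[OF \<rho>E \<pi>E] d_sym[OF \<rho>E \<mu>E] by simp
  moreover have "2 * e + 4 * k \<le> b * T" using e(3) k(1) by linarith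
  ultimately have low: "- (2 * (b * T)) \<le> a * ((d (S T \<rho>) \<pi>)\<^sup>2 / 2 - (d \<rho> \<pi>)\<^sup>2 / 2 + ((d (S T \<rho>) \<mu>)\<^sup>2 / 2 - (d \<rho> \<mu>)\<^sup>2 / 2))"
    by (simp add: algebra_simps)
  also have "\<dots> \<le> a * ((E1 - l + 2 * b - \<kappa> / 2 * D1\<^sup>2) * T + (E2 - l + 2 * b - \<kappa> / 2 * D2\<^sup>2) * T)"
    using a by (intro mult_left_mono add_mono evi1 evi2) auto
  also have "\<dots> = (a * (E1 + E2 - 2 * l + 4 * b - \<kappa> / 2 * (D1\<^sup>2 + D2\<^sup>2))) * T"
    by (simp add: algebra_simps)
  finally have "(- (2 * b)) * T \<le> (a * (E1 + E2 - 2 * l + 4 * b - \<kappa> / 2 * (D1\<^sup>2 + D2\<^sup>2))) * T"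
    by simp
  \<comment> \<open>both sides are of order \<open>T\<close>, which is why the tolerances had to be small relative to \<open>T\<close>\<close>
  then have low2: "- (2 * b) \<le> a * (E1 + E2 - 2 * l + 4 * b - \<kappa> / 2 * (D1\<^sup>2 + D2\<^sup>2))"
    using T(1) by (simp only: mult_le_cancel_right_pos)
  have "ereal E0 < ereal (l + b)"
    using r(1) dom_ereal[OF \<rho>'(1)] by (simp add: E0_def \<rho>'_def)
  then have "a * (2 * E0) \<le> a * (2 * (l + b))" using a by simp
  with low2 have conv: "a * (2 * E0 - E1 - E2) \<le> 2 * b + 6 * a * b - a * \<kappa> / 2 * (D1\<^sup>2 + D2\<^sup>2)"
    by (simp add: algebra_simps)
  \<comment> \<open>the triple is almost optimal, hence its centre almost equidistant\<close>
  have bT: "b * T \<le> b * 1" using b T by (intro mult_left_mono) auto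
  have opt: "M - 2 * b \<le> u \<pi> - v \<mu> - a / 2 * (D1\<^sup>2 + D2\<^sup>2)"
  proof -
    have "M - b - 2 * e - 2 * k \<le> u \<pi> - v \<mu> - (a / 2 * D1\<^sup>2 + a / 2 * D2\<^sup>2)"
      using \<rho>(3) U2 V2 \<pi>(2) \<mu>(2) unfolding G_def D1_def D2_def by linarith
    then show ?thesis using e(3) k bT b unfolding distrib_left by linarith
  qed
  have tri: "d \<pi> \<mu> \<le> D1 + D2"
    using d_tri[OF \<pi>E \<rho>'(2) \<mu>E] d_sym[OF \<mu>E \<rho>'(2)] by (simp add: D1_def D2_def)
  have "a / 4 * (d \<pi> \<mu>)\<^sup>2 \<le> a / 4 * (D1 + D2)\<^sup>2"
    using tri a d_nonneg by (intro mult_left_mono power_mono) auto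
  with doubled_sup_midpoint[OF a \<pi>E \<mu>E] opt
  have "a / 2 * (D1\<^sup>2 + D2\<^sup>2) \<le> a / 4 * (D1 + D2)\<^sup>2 + 2 * b"
    unfolding M_def by linarith
  then have "a * (D1 - D2)\<^sup>2 \<le> 8 * b"
    by (simp add: power2_eq_square algebra_simps)
  then have "(D1 - D2)\<^sup>2 \<le> 8 * b / a" using a by (simp add: field_simps)
  then have diff: "D1 - D2 \<le> sqrt (8 * b / a)" by (rule real_le_rsqrt)
  have "D1\<^sup>2 - D2\<^sup>2 = (D1 - D2) * (D1 + D2)" by (simp add: power2_eq_square algebra_simps)
  also have "\<dots> \<le> sqrt (8 * b / a) * (2 * R)"
    using diff D1 D2 a b by (intro mult_mono) auto
  finally have "a\<^sup>2 / 2 * (D1\<^sup>2 - D2\<^sup>2) \<le> a\<^sup>2 / 2 * (sqrt (8 * b / a) * (2 * R))"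
    by (intro mult_left_mono) auto
  then have quad: "a\<^sup>2 / 2 * (D1\<^sup>2 - D2\<^sup>2) \<le> a\<^sup>2 * R * sqrt (8 * b / a)"
    by (simp add: mult_ac)
  have lin: "a * b * (D1 + D2) \<le> 2 * a * b * R"
    using mult_left_mono[of "D1 + D2" "2 * R" "a * b"] D1 D2 a b by simp
  have kap: "- (a * \<kappa> * (D1\<^sup>2 + D2\<^sup>2)) \<le> \<bar>\<kappa>\<bar> * (a * (D1\<^sup>2 + D2\<^sup>2))"
  proof -
    have "(- \<kappa>) * (a * (D1\<^sup>2 + D2\<^sup>2)) \<le> \<bar>\<kappa>\<bar> * (a * (D1\<^sup>2 + D2\<^sup>2))"
      using a by (intro mult_right_mono) auto
    then show ?thesis by (simp add: mult_ac)
  qed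
  have collect: "p - z + 2 * b + q + s + b' \<le> k + 4 * b + c + q' + s' + b'"
    if "p \<le> 2 * b + c - z" "q \<le> q'" "s \<le> s'" "- (2 * z) \<le> k" for p z q s b' k c q' s' :: real
    using that by linarith
  define X1 where "X1 = a * (E0 - E1) - a * (\<kappa> / 2) * D1\<^sup>2 + b + a\<^sup>2 / 2 * D1\<^sup>2 + a * b * D1 + b\<^sup>2 / 2"
  define X2 where "X2 = a * (E2 - E0) + a * (\<kappa> / 2) * D2\<^sup>2 - b + a\<^sup>2 / 2 * D2\<^sup>2 - a * b * D2 - b\<^sup>2 / 2"
  have "u \<pi> - v \<mu> \<le> h1 \<pi> - h2 \<mu> + (lam * X1 - lam * X2) + 2 * e"
    using \<pi>(3) \<mu>(3) unfolding X1_def X2_def D1_def D2_def E1_def E2_def by linarith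
  also have "lam * X1 - lam * X2 = lam * (X1 - X2)" by (simp add: algebra_simps)
  also have "X1 - X2 = a * (2 * E0 - E1 - E2) - a * \<kappa> / 2 * (D1\<^sup>2 + D2\<^sup>2) + 2 * b
      + a\<^sup>2 / 2 * (D1\<^sup>2 - D2\<^sup>2) + a * b * (D1 + D2) + b\<^sup>2"
    unfolding X1_def X2_def by (simp add: algebra_simps)
  also have "\<dots> \<le> \<bar>\<kappa>\<bar> * (a * (D1\<^sup>2 + D2\<^sup>2)) + 4 * b + 6 * a * b + a\<^sup>2 * R * sqrt (8 * b / a) + 2 * a * b * R + b\<^sup>2"
    by (rule collect[OF conv quad lin]) (use kap in simp)
  finally have main: "u \<pi> - v \<mu> \<le> h1 \<pi> - h2 \<mu> + lam * (\<bar>\<kappa>\<bar> * (a * (D1\<^sup>2 + D2\<^sup>2))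
        + 4 * b + 6 * a * b + a\<^sup>2 * R * sqrt (8 * b / a) + 2 * a * b * R + b\<^sup>2) + 2 * e"
    using lam by simp
  have "2 * e \<le> 2 * b" using e(3) bT b by linarith
  with main opt show ?thesis
    by (intro that[OF \<pi>E \<mu>E \<rho>'(2)]) (auto simp: D1_def D2_def M_def)
qed

end

subsection \<open>Comparison\<close>

text \<open>
  The error terms of \<open>doubling_estimate\<close> vanish as \<open>b\<close> tends to \<open>0\<close> except for the penalty
  \<open>a (d(\<pi>,\<rho>)\<^sup>2 + d(\<mu>,\<rho>)\<^sup>2)\<close>. That one is controlled by the drop of \<open>doubled_sup\<close> when \<open>a\<close> is doubled, and
  along the powers of two the drop is arbitrarily small somewhere since the values are bounded below.
  The same bound brings \<open>\<pi>\<close> and \<open>\<mu>\<close> together, so that uniform continuity of \<open>h2\<close> applies.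
\<close>

lemma comparison_principle:
  assumes "0 < lam"
    and h1: "bounded (h1 ` E)"
    and h2: "bounded (h2 ` E)" "uniformly_cont_on E d h2"
    and sub: "viscosity_subsolution E d (H_dagger E d en S \<kappa>) lam h1 u"
    and super: "viscosity_supersolution E d (H_ddagger E d en S \<kappa>) lam h2 v"
  shows "(SUP \<pi>\<in>E. u \<pi> - v \<pi>) \<le> (SUP \<pi>\<in>E. h1 \<pi> - h2 \<pi>)"
proof -
  have bound: "\<exists>B. \<forall>\<pi>\<in>E. \<bar>w \<pi>\<bar> \<le> B" if "bounded (w ` E)" for w :: "'e \<Rightarrow> real"
    using that by (auto simp: bounded_iff)
  have "bounded (u ` E)" "bounded (v ` E)"
    using sub super by (simp_all add: viscosity_subsolution_def viscosity_supersolution_def)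
  then obtain Bu Bv where "\<forall>\<pi>\<in>E. \<bar>u \<pi>\<bar> \<le> Bu" "\<forall>\<pi>\<in>E. \<bar>v \<pi>\<bar> \<le> Bv"
    using bound by metis
  then obtain B where B: "\<And>\<pi>. \<pi> \<in> E \<Longrightarrow> \<bar>u \<pi>\<bar> \<le> B" "\<And>\<pi>. \<pi> \<in> E \<Longrightarrow> \<bar>v \<pi>\<bar> \<le> B"
    by (metis max.coboundedI1 max.coboundedI2)
  obtain B1 B2 where B12: "\<forall>\<pi>\<in>E. \<bar>h1 \<pi>\<bar> \<le> B1" "\<forall>\<pi>\<in>E. \<bar>h2 \<pi>\<bar> \<le> B2"
    using bound[OF h1] bound[OF h2(1)] by blast
  define K where "K = (SUP \<pi>\<in>E. h1 \<pi> - h2 \<pi>)"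
  have K: "h1 \<pi> - h2 \<pi> \<le> K" if "\<pi> \<in> E" for \<pi>
    unfolding K_def using that B12 by (intro cSUP_upper bdd_aboveI2[of _ _ "B1 + B2"]) fastforce+
  have main: "u \<pi>0 - v \<pi>0 \<le> K + 6 * \<epsilon>" if \<pi>0: "\<pi>0 \<in> E" and "0 < \<epsilon>" for \<pi>0 \<epsilon>
  proof -
    obtain r where r: "0 < r" "\<And>\<pi> \<mu>. \<pi> \<in> E \<Longrightarrow> \<mu> \<in> E \<Longrightarrow> d \<pi> \<mu> < r \<Longrightarrow> \<bar>h2 \<pi> - h2 \<mu>\<bar> < \<epsilon>"
      using h2(2) \<open>0 < \<epsilon>\<close> unfolding uniformly_cont_on_def by meson
    define \<eta> where "\<eta> = min (\<epsilon> / (lam * \<bar>\<kappa>\<bar> + 1)) (r\<^sup>2 / 4)"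
    have "0 \<le> lam * \<bar>\<kappa>\<bar>" using assms(1) by simp
    then have "0 < \<eta>" using r(1) \<open>0 < \<epsilon>\<close> unfolding \<eta>_def by auto
    moreover have "\<eta> \<le> r\<^sup>2 / 4" "\<eta> \<le> \<epsilon> / (lam * \<bar>\<kappa>\<bar> + 1)"
      unfolding \<eta>_def by (rule min.cobounded2, rule min.cobounded1)
    ultimately have \<eta>: "0 < \<eta>" "\<eta> \<le> r\<^sup>2 / 4" "\<eta> \<le> \<epsilon> / (lam * \<bar>\<kappa>\<bar> + 1)" .
    have "lam * \<bar>\<kappa>\<bar> * \<eta> \<le> lam * \<bar>\<kappa>\<bar> * (\<epsilon> / (lam * \<bar>\<kappa>\<bar> + 1))"
      using \<eta>(3) \<open>0 \<le> lam * \<bar>\<kappa>\<bar>\<close> by (intro mult_left_mono)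
    also have "\<dots> \<le> \<epsilon>"
      using \<open>0 \<le> lam * \<bar>\<kappa>\<bar>\<close> \<open>0 < \<epsilon>\<close> by (simp add: field_simps add_nonneg_pos)
    finally have \<eta>\<epsilon>: "lam * \<bar>\<kappa>\<bar> * \<eta> \<le> \<epsilon>" .
    define X where "X n = doubled_sup u v (2 ^ n)" for n :: nat
    \<comment> \<open>a bounded sequence cannot drop by a fixed amount at every step\<close>
    obtain n where n: "X n - X (Suc n) < \<eta> / 4"
    proof (rule ccontr)
      assume "\<not> thesis"
      then have *: "X (Suc n) \<le> X n - \<eta> / 4" for n using that[of n] by fastforce
      have X: "X n \<le> X 0 - real n * (\<eta> / 4)" for n
      proof (induction n)
        case (Suc n)
        then show ?case using *[of n] unfolding of_nat_Suc distrib_right by linarith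
      qed simp
      have "u \<pi>0 - v \<pi>0 \<le> X n" for n
        unfolding X_def by (rule difference_le_doubled_sup[where B = B, OF B _ \<pi>0]) auto
      then have "real n * (\<eta> / 4) \<le> X 0 - (u \<pi>0 - v \<pi>0)" for n
        using X[of n] by (smt (verit))
      moreover obtain n where "X 0 - (u \<pi>0 - v \<pi>0) < real n * (\<eta> / 4)"
        using ex_less_of_nat_mult[of "\<eta> / 4" "X 0 - (u \<pi>0 - v \<pi>0)"] \<eta>(1) by auto
      ultimately show False by (meson not_less)
    qed
    define a :: real where "a = 2 ^ Suc n"
    have a: "0 < a" "2 \<le> a" by (auto simp: a_def)
    define R where "R = sqrt ((4 * B + 2) / a)"
    define err where "err b = lam * (4 * b + 6 * a * b + a\<^sup>2 * R * sqrt (8 * b / a) + 2 * a * b * R + b\<^sup>2) + 2 * b" for b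
    have "(err \<longlongrightarrow> lam * (4 * 0 + 6 * a * 0 + a\<^sup>2 * R * sqrt (8 * 0 / a) + 2 * a * 0 * R + 0\<^sup>2) + 2 * 0) (at_right 0)"
      unfolding err_def using a by (intro tendsto_intros) auto
    then have "(err \<longlongrightarrow> 0) (at_right 0)" by simp
    then have "\<forall>\<^sub>F b in at_right 0. err b < \<epsilon>"
      using \<open>0 < \<epsilon>\<close> by (rule order_tendstoD)
    moreover have "\<forall>\<^sub>F b in at_right 0. b \<in> {0<..<\<eta> / 8}"
      using \<eta>(1) by (intro eventually_at_right_real) auto
    moreover have "\<forall>\<^sub>F b in at_right 0. b \<in> {0<..<\<epsilon>}"
      using \<open>0 < \<epsilon>\<close> by (rule eventually_at_right_real)
    ultimately have "\<forall>\<^sub>F b in at_right 0. err b < \<epsilon> \<and> 0 < b \<and> b < \<eta> / 8 \<and> b < \<epsilon>"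
      by eventually_elim auto
    then obtain b where b: "err b < \<epsilon>" "0 < b" "b < \<eta> / 8" "b < \<epsilon>"
      using eventually_happens trivial_limit_at_right_real by blast
    obtain \<pi> \<mu> \<rho> where E: "\<pi> \<in> E" "\<mu> \<in> E" "\<rho> \<in> E"
      and opt: "doubled_sup u v a - 2 * b \<le> u \<pi> - v \<mu> - a / 2 * ((d \<pi> \<rho>)\<^sup>2 + (d \<mu> \<rho>)\<^sup>2)"
      and ineq: "u \<pi> - v \<mu> \<le> h1 \<pi> - h2 \<mu> + lam * (\<bar>\<kappa>\<bar> * (a * ((d \<pi> \<rho>)\<^sup>2 + (d \<mu> \<rho>)\<^sup>2))
        + 4 * b + 6 * a * b + a\<^sup>2 * R * sqrt (8 * b / a) + 2 * a * b * R + b\<^sup>2) + 2 * b"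
      using doubling_estimate[where B = B, OF B sub super a(1) b(2) assms(1)] unfolding R_def by blast
    define D where "D = (d \<pi> \<rho>)\<^sup>2 + (d \<mu> \<rho>)\<^sup>2"
    have D0: "0 \<le> D" by (simp add: D_def)
    \<comment> \<open>the triple that is almost optimal for \<open>a\<close> is a competitor for \<open>a / 2\<close>\<close>
    have "u \<pi> - v \<mu> - (a / 2) / 2 * D \<le> doubled_sup u v (a / 2)"
      unfolding D_def by (rule doubled_sup_upper[where B = B, OF B]) (use a E in auto)
    moreover have "doubled_sup u v (a / 2) = X n" "doubled_sup u v a = X (Suc n)"
      by (auto simp: X_def a_def)
    ultimately have "a / 4 * D \<le> \<eta> / 4 + 2 * b"
      using opt n unfolding D_def[symmetric] by simp
    then have aD: "a * D \<le> 2 * \<eta>" using b(3) by simp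
    have pen: "lam * (\<bar>\<kappa>\<bar> * (a * D)) \<le> 2 * \<epsilon>"
    proof -
      have "lam * \<bar>\<kappa>\<bar> * (a * D) \<le> lam * \<bar>\<kappa>\<bar> * (2 * \<eta>)"
        using aD \<open>0 \<le> lam * \<bar>\<kappa>\<bar>\<close> by (rule mult_left_mono)
      then show ?thesis using \<eta>\<epsilon> by (simp add: mult.assoc)
    qed
    have "2 * D \<le> a * D" using a(2) D0 by (rule mult_right_mono)
    then have "4 * D \<le> r\<^sup>2" using aD \<eta>(2) by simp
    have "(d \<pi> \<mu>)\<^sup>2 \<le> (d \<pi> \<rho> + d \<mu> \<rho>)\<^sup>2"
      using d_tri[OF E(1,3,2)] d_sym[OF E(2,3)] d_nonneg by (intro power_mono) auto
    also have "\<dots> \<le> 2 * D"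
      using sum_squares_bound[of "d \<pi> \<rho>" "d \<mu> \<rho>"] by (simp add: D_def power2_eq_square algebra_simps)
    also have "\<dots> < r\<^sup>2"
    proof -
      have "0 < r\<^sup>2" using r(1) by simp
      with \<open>4 * D \<le> r\<^sup>2\<close> D0 show ?thesis by linarith
    qed
    finally have "d \<pi> \<mu> < r" using r(1) by (simp add: power_less_imp_less_base)
    then have "\<bar>h2 \<pi> - h2 \<mu>\<bar> < \<epsilon>" by (rule r(2)[OF E(1,2)])
    moreover have "u \<pi> - v \<mu> \<le> h1 \<pi> - h2 \<mu> + lam * (\<bar>\<kappa>\<bar> * (a * D)) + err b"
      using ineq unfolding err_def D_def[symmetric] by (simp add: algebra_simps)
    moreover have "0 \<le> a / 2 * D" using a D0 by simp
    moreover have "u \<pi>0 - v \<pi>0 \<le> doubled_sup u v a"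
      by (rule difference_le_doubled_sup[where B = B, OF B a(1) \<pi>0])
    ultimately have "u \<pi>0 - v \<pi>0 \<le> h1 \<pi> - h2 \<pi> + 4 * \<epsilon> + 2 * b"
      using opt b(1) pen unfolding D_def[symmetric] by linarith
    then show ?thesis using K[OF E(1)] b(4) by linarith
  qed
  show ?thesis
    unfolding K_def[symmetric]
  proof (rule cSUP_least[OF E_nonempty], rule field_le_epsilon)
    fix \<pi> and e :: real assume "\<pi> \<in> E" "0 < e"
    then show "u \<pi> - v \<pi> \<le> K + e" using main[of \<pi> "e / 6"] by simp
  qed
qed

end

section \<open>Couplings and the Wasserstein distance\<close>

abbreviation transport_cost :: "('a::euclidean_space \<times> 'a) measure \<Rightarrow> ennreal" where
  "transport_cost \<pi> \<equiv> \<integral>\<^sup>+ z. ennreal ((norm (fst z - snd z))\<^sup>2) \<partial>\<pi>"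

text \<open>Finite moments are easier to carry through couplings as nonnegative integrals.\<close>

lemma P2_iff:
  fixes \<mu> :: "'a::euclidean_space measure"
  shows "\<mu> \<in> P2 \<longleftrightarrow> prob_space \<mu> \<and> sets \<mu> = sets borel \<and> (\<integral>\<^sup>+ x. ennreal ((norm x)\<^sup>2) \<partial>\<mu>) < \<infinity>"
proof -
  have "integrable \<mu> (\<lambda>x. (norm x)\<^sup>2) \<longleftrightarrow> (\<integral>\<^sup>+ x. ennreal ((norm x)\<^sup>2) \<partial>\<mu>) < \<infinity>" if "sets \<mu> = sets borel"
  proof -
    have [measurable_cong]: "sets \<mu> = sets borel" by fact
    show ?thesis by (subst integrable_iff_bounded) auto
  qed
  then show ?thesis by (auto simp: P2_def)
qed

lemma couplingsD:
  assumes "\<pi> \<in> couplings \<mu> \<nu>"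
  shows "sets \<pi> = sets (borel \<Otimes>\<^sub>M borel)" "distr \<pi> borel fst = \<mu>" "distr \<pi> borel snd = \<nu>"
    "fst \<in> measurable \<pi> borel" "snd \<in> measurable \<pi> borel"
proof -
  show s: "sets \<pi> = sets (borel \<Otimes>\<^sub>M borel)" and "distr \<pi> borel fst = \<mu>" "distr \<pi> borel snd = \<nu>"
    using assms by (auto simp: couplings_def)
  show "fst \<in> measurable \<pi> borel" "snd \<in> measurable \<pi> borel"
    by (subst measurable_cong_sets[OF s refl], simp)+
qed

lemma prob_space_coupling:
  assumes "\<pi> \<in> couplings \<mu> \<nu>" "prob_space \<mu>"
  shows "prob_space \<pi>"
  using prob_space_distrD[OF couplingsD(4)[OF assms(1)]] couplingsD(2)[OF assms(1)] assms(2) by simp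

lemma nn_integral_coupling:
  assumes \<pi>: "\<pi> \<in> couplings \<mu> \<nu>" and f: "f \<in> borel_measurable borel"
  shows "(\<integral>\<^sup>+ z. f (fst z) \<partial>\<pi>) = (\<integral>\<^sup>+ x. f x \<partial>\<mu>)" "(\<integral>\<^sup>+ z. f (snd z) \<partial>\<pi>) = (\<integral>\<^sup>+ x. f x \<partial>\<nu>)"
proof -
  show "(\<integral>\<^sup>+ z. f (fst z) \<partial>\<pi>) = (\<integral>\<^sup>+ x. f x \<partial>\<mu>)"
    by (subst couplingsD(2)[OF \<pi>, symmetric]) (simp add: nn_integral_distr[OF couplingsD(4)[OF \<pi>]] f)
  show "(\<integral>\<^sup>+ z. f (snd z) \<partial>\<pi>) = (\<integral>\<^sup>+ x. f x \<partial>\<nu>)"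
    by (subst couplingsD(3)[OF \<pi>, symmetric]) (simp add: nn_integral_distr[OF couplingsD(5)[OF \<pi>]] f)
qed

lemma couplings_distrI:
  assumes M: "\<phi> \<in> measurable M borel" "\<psi> \<in> measurable M borel"
    and eq: "distr M borel \<phi> = \<mu>" "distr M borel \<psi> = \<nu>"
  shows "distr M (borel \<Otimes>\<^sub>M borel) (\<lambda>z. (\<phi> z, \<psi> z)) \<in> couplings \<mu> \<nu>"
proof -
  have [measurable]: "\<phi> \<in> measurable M borel" "\<psi> \<in> measurable M borel" by fact+
  show ?thesis
    unfolding couplings_def using eq by (auto simp: distr_distr comp_def)
qed

lemma transport_cost_distr:
  fixes \<phi> \<psi> :: "'b \<Rightarrow> 'a::euclidean_space"
  assumes [measurable]: "\<phi> \<in> measurable M borel" "\<psi> \<in> measurable M borel"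
  shows "transport_cost (distr M (borel \<Otimes>\<^sub>M borel) (\<lambda>z. (\<phi> z, \<psi> z))) =
    (\<integral>\<^sup>+ z. ennreal ((norm (\<phi> z - \<psi> z))\<^sup>2) \<partial>M)"
  by (subst nn_integral_distr) auto

lemma product_coupling:
  assumes "prob_space \<mu>" "prob_space \<nu>" "sets \<mu> = sets borel" "sets \<nu> = sets borel"
  shows "\<mu> \<Otimes>\<^sub>M \<nu> \<in> couplings \<mu> \<nu>"
proof -
  interpret \<mu>: prob_space \<mu> by fact
  interpret \<nu>: prob_space \<nu> by fact
  have "distr (\<mu> \<Otimes>\<^sub>M \<nu>) \<mu> fst = \<mu>"
    by (rule \<nu>.distr_pair_fst)
  moreover have "distr (\<mu> \<Otimes>\<^sub>M \<nu>) \<nu> snd = \<nu>"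
  proof (rule measure_eqI)
    fix A assume "A \<in> sets (distr (\<mu> \<Otimes>\<^sub>M \<nu>) \<nu> snd)"
    then have A: "A \<in> sets \<nu>" by simp
    then have "snd -` A \<inter> space (\<mu> \<Otimes>\<^sub>M \<nu>) = space \<mu> \<times> A"
      using sets.sets_into_space by (auto simp: space_pair_measure)
    then show "emeasure (distr (\<mu> \<Otimes>\<^sub>M \<nu>) \<nu> snd) A = emeasure \<nu> A"
      using A by (simp add: emeasure_distr \<nu>.emeasure_pair_measure_Times \<mu>.emeasure_space_1)
  qed simp
  moreover have "distr (\<mu> \<Otimes>\<^sub>M \<nu>) borel fst = distr (\<mu> \<Otimes>\<^sub>M \<nu>) \<mu> fst" "distr (\<mu> \<Otimes>\<^sub>M \<nu>) borel snd = distr (\<mu> \<Otimes>\<^sub>M \<nu>) \<nu> snd"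
    using assms by (auto intro!: distr_cong)
  ultimately show ?thesis
    unfolding couplings_def using assms by (auto intro!: sets_pair_measure_cong)
qed

lemma norm_diff_sq_le: "(norm (x - y :: 'a::real_normed_vector))\<^sup>2 \<le> 2 * (norm x)\<^sup>2 + 2 * (norm y)\<^sup>2"
proof -
  have "(norm (x - y))\<^sup>2 \<le> (norm x + norm y)\<^sup>2"
    by (intro power_mono norm_triangle_ineq4) auto
  also have "\<dots> \<le> 2 * (norm x)\<^sup>2 + 2 * (norm y)\<^sup>2"
    using sum_squares_bound[of "norm x" "norm y"] by (simp add: power2_eq_square algebra_simps)
  finally show ?thesis .
qed

lemma transport_cost_finite:
  assumes \<mu>: "\<mu> \<in> P2" and \<nu>: "\<nu> \<in> P2" and \<pi>: "\<pi> \<in> couplings \<mu> \<nu>"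
  shows "transport_cost \<pi> < \<infinity>"
proof -
  have [measurable]: "fst \<in> measurable \<pi> borel" "snd \<in> measurable \<pi> borel"
    using couplingsD[OF \<pi>] by auto
  have "transport_cost \<pi> \<le> (\<integral>\<^sup>+ z. 2 * ennreal ((norm (fst z))\<^sup>2) + 2 * ennreal ((norm (snd z))\<^sup>2) \<partial>\<pi>)"
    by (intro nn_integral_mono)
       (use norm_diff_sq_le in \<open>auto simp: ennreal_plus[symmetric] ennreal_mult'[symmetric] simp flip: ennreal_numeral simp del: ennreal_plus\<close>)
  also have "\<dots> = 2 * (\<integral>\<^sup>+ z. ennreal ((norm (fst z))\<^sup>2) \<partial>\<pi>) + 2 * (\<integral>\<^sup>+ z. ennreal ((norm (snd z))\<^sup>2) \<partial>\<pi>)"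
    by (subst nn_integral_add) (auto simp: nn_integral_cmult)
  also have "\<dots> = 2 * (\<integral>\<^sup>+ x. ennreal ((norm x)\<^sup>2) \<partial>\<mu>) + 2 * (\<integral>\<^sup>+ x. ennreal ((norm x)\<^sup>2) \<partial>\<nu>)"
    by (simp add: nn_integral_coupling[OF \<pi>, where f = "\<lambda>x. ennreal ((norm x)\<^sup>2)"])
  also have "\<dots> < \<infinity>"
    using \<mu> \<nu> by (auto simp: P2_iff ennreal_mult_less_top)
  finally show ?thesis .
qed

lemma W2_nonneg: "0 \<le> W2 \<mu> \<nu>"
  by (simp add: W2_def)

lemma W2_le:
  assumes "\<pi> \<in> couplings \<mu> \<nu>" "transport_cost \<pi> \<le> ennreal (c\<^sup>2)" "0 \<le> c"
  shows "W2 \<mu> \<nu> \<le> c"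
proof -
  have "(INF \<pi>\<in>couplings \<mu> \<nu>. transport_cost \<pi>) \<le> ennreal (c\<^sup>2)"
    using assms(1,2) by (meson INF_lower2)
  then have "enn2real (INF \<pi>\<in>couplings \<mu> \<nu>. transport_cost \<pi>) \<le> c\<^sup>2"
    by (simp add: enn2real_leI)
  then show ?thesis
    unfolding W2_def using assms(3) by (simp add: real_le_lsqrt)
qed

lemma W2_approx:
  assumes "\<mu> \<in> P2" "\<nu> \<in> P2" "0 < e"
  obtains \<pi> where "\<pi> \<in> couplings \<mu> \<nu>" "transport_cost \<pi> \<le> ennreal ((W2 \<mu> \<nu> + e)\<^sup>2)"
proof -
  let ?I = "INF \<pi>\<in>couplings \<mu> \<nu>. transport_cost \<pi>"
  have prod: "\<mu> \<Otimes>\<^sub>M \<nu> \<in> couplings \<mu> \<nu>"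
    using assms by (intro product_coupling) (auto simp: P2_iff)
  have "?I \<le> transport_cost (\<mu> \<Otimes>\<^sub>M \<nu>)" by (rule INF_lower[OF prod])
  also have "\<dots> < \<infinity>" by (rule transport_cost_finite[OF assms(1,2) prod])
  finally have "?I = ennreal (enn2real ?I)" by simp
  also have "\<dots> = ennreal ((W2 \<mu> \<nu>)\<^sup>2)" by (simp add: W2_def)
  also have "\<dots> < ennreal ((W2 \<mu> \<nu> + e)\<^sup>2)"
    using W2_nonneg[of \<mu> \<nu>] assms(3) by (intro ennreal_lessI power_strict_mono) auto
  finally show ?thesis using that by (auto simp: INF_less_iff less_imp_le)
qed

lemma W2_refl:
  assumes "\<mu> \<in> P2" shows "W2 \<mu> \<mu> = 0"
proof (rule antisym[OF _ W2_nonneg])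
  have s[measurable_cong]: "sets \<mu> = sets borel" using assms by (simp add: P2_iff)
  have "distr \<mu> borel (\<lambda>x. x) = \<mu>" by (rule distr_id2[OF s[symmetric]])
  then have "distr \<mu> (borel \<Otimes>\<^sub>M borel) (\<lambda>x. (x, x)) \<in> couplings \<mu> \<mu>"
    by (intro couplings_distrI) auto
  then show "W2 \<mu> \<mu> \<le> 0"
    by (rule W2_le) (auto simp: transport_cost_distr)
qed

lemma W2_sym_le:
  assumes "\<mu> \<in> P2" "\<nu> \<in> P2" shows "W2 \<mu> \<nu> \<le> W2 \<nu> \<mu>"
proof (rule field_le_epsilon)
  fix e :: real assume "0 < e"
  then obtain \<pi> where \<pi>: "\<pi> \<in> couplings \<nu> \<mu>" "transport_cost \<pi> \<le> ennreal ((W2 \<nu> \<mu> + e)\<^sup>2)"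
    using W2_approx[OF assms(2,1)] by blast
  note m = couplingsD[OF \<pi>(1)]
  show "W2 \<mu> \<nu> \<le> W2 \<nu> \<mu> + e"
  proof (rule W2_le)
    show "distr \<pi> (borel \<Otimes>\<^sub>M borel) (\<lambda>z. (snd z, fst z)) \<in> couplings \<mu> \<nu>"
      using m by (intro couplings_distrI) auto
    show "transport_cost (distr \<pi> (borel \<Otimes>\<^sub>M borel) (\<lambda>z. (snd z, fst z))) \<le> ennreal ((W2 \<nu> \<mu> + e)\<^sup>2)"
      using \<pi>(2) by (subst transport_cost_distr) (use m in \<open>auto simp: norm_minus_commute\<close>)
  qed (use \<open>0 < e\<close> W2_nonneg[of \<nu> \<mu>] in simp)
qed

lemma W2_sym: "\<mu> \<in> P2 \<Longrightarrow> \<nu> \<in> P2 \<Longrightarrow> W2 \<mu> \<nu> = W2 \<nu> \<mu>"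
  by (intro antisym W2_sym_le)

text \<open>
  The image of a nearly optimal coupling under \<open>(x, y) \<mapsto> (x + y) / 2\<close> is an approximate midpoint: its
  natural couplings with the marginals halve every displacement.
\<close>

lemma W2_midpoint:
  fixes \<mu> \<nu> :: "'a::euclidean_space measure"
  assumes "\<mu> \<in> P2" "\<nu> \<in> P2" "0 < e"
  shows "\<exists>m\<in>P2. W2 \<mu> m \<le> W2 \<mu> \<nu> / 2 + e \<and> W2 \<nu> m \<le> W2 \<mu> \<nu> / 2 + e"
proof -
  define c where "c = W2 \<mu> \<nu> / 2 + e"
  have c: "0 \<le> c" using assms(3) W2_nonneg[of \<mu> \<nu>] by (simp add: c_def)
  have "0 < 2 * e" using assms(3) by simp
  then obtain \<pi> where \<pi>: "\<pi> \<in> couplings \<mu> \<nu>" "transport_cost \<pi> \<le> ennreal ((W2 \<mu> \<nu> + 2 * e)\<^sup>2)"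
    using W2_approx[OF assms(1,2)] by blast
  note meas[measurable] = couplingsD(4,5)[OF \<pi>(1)]
  interpret \<pi>: prob_space \<pi>
    using prob_space_coupling[OF \<pi>(1)] assms by (simp add: P2_iff)
  define f where "f = (\<lambda>z :: 'a \<times> 'a. (1/2) *\<^sub>R (fst z + snd z))"
  have f[measurable]: "f \<in> measurable \<pi> borel" unfolding f_def by measurable
  define m where "m = distr \<pi> borel f"
  have "(\<integral>\<^sup>+ x. ennreal ((norm x)\<^sup>2) \<partial>m) = (\<integral>\<^sup>+ z. ennreal ((norm (f z))\<^sup>2) \<partial>\<pi>)"
    unfolding m_def by (subst nn_integral_distr) auto
  also have "\<dots> \<le> (\<integral>\<^sup>+ z. ennreal ((norm (fst z))\<^sup>2) + ennreal ((norm (snd z))\<^sup>2) \<partial>\<pi>)"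
  proof (intro nn_integral_mono)
    fix z :: "'a \<times> 'a"
    have "(norm (f z))\<^sup>2 = (norm (fst z - (- snd z)))\<^sup>2 / 4"
      by (simp add: f_def power_divide)
    also have "\<dots> \<le> (norm (fst z))\<^sup>2 + (norm (snd z))\<^sup>2"
      using norm_diff_sq_le[of "fst z" "- snd z"] zero_le_power2[of "norm (fst z)"] zero_le_power2[of "norm (snd z)"]
      unfolding norm_minus_cancel by linarith
    finally have "(norm (f z))\<^sup>2 \<le> (norm (fst z))\<^sup>2 + (norm (snd z))\<^sup>2" .
    then show "ennreal ((norm (f z))\<^sup>2) \<le> ennreal ((norm (fst z))\<^sup>2) + ennreal ((norm (snd z))\<^sup>2)"
      by (simp add: ennreal_plus[symmetric] del: ennreal_plus)
  qed
  also have "\<dots> = (\<integral>\<^sup>+ x. ennreal ((norm x)\<^sup>2) \<partial>\<mu>) + (\<integral>\<^sup>+ x. ennreal ((norm x)\<^sup>2) \<partial>\<nu>)"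
    by (subst nn_integral_add)
       (auto simp: nn_integral_coupling[OF \<pi>(1), where f = "\<lambda>x. ennreal ((norm x)\<^sup>2)"])
  also have "\<dots> < \<infinity>" using assms by (simp add: P2_iff)
  finally have "m \<in> P2"
    using \<pi>.prob_space_distr[OF f] by (simp add: P2_iff m_def)
  have cost: "(\<integral>\<^sup>+ z. ennreal ((norm (\<phi> z - f z))\<^sup>2) \<partial>\<pi>) \<le> ennreal (c\<^sup>2)"
    if "\<And>z. norm (\<phi> z - f z) = norm (fst z - snd z) / 2" for \<phi>
  proof -
    have "(\<integral>\<^sup>+ z. ennreal ((norm (\<phi> z - f z))\<^sup>2) \<partial>\<pi>) = (\<integral>\<^sup>+ z. ennreal (1/4) * ennreal ((norm (fst z - snd z))\<^sup>2) \<partial>\<pi>)"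
      unfolding that by (intro nn_integral_cong) (simp add: power_divide ennreal_mult'[symmetric] del: ennreal_divide_numeral)
    also have "\<dots> = ennreal (1/4) * transport_cost \<pi>"
      by (rule nn_integral_cmult) measurable
    also have "\<dots> \<le> ennreal (1/4) * ennreal ((W2 \<mu> \<nu> + 2 * e)\<^sup>2)"
      by (intro mult_left_mono \<pi>(2)) auto
    also have "\<dots> = ennreal (1/4 * (W2 \<mu> \<nu> + 2 * e)\<^sup>2)"
      by (rule ennreal_mult'[symmetric]) simp
    also have "1/4 * (W2 \<mu> \<nu> + 2 * e)\<^sup>2 = c\<^sup>2"
      by (simp add: c_def power2_eq_square field_simps)
    finally show ?thesis .
  qed
  have "W2 \<mu> m \<le> c"
  proof (rule W2_le[OF _ _ c])
    show "distr \<pi> (borel \<Otimes>\<^sub>M borel) (\<lambda>z. (fst z, f z)) \<in> couplings \<mu> m"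
      using couplingsD[OF \<pi>(1)] by (intro couplings_distrI) (auto simp: m_def)
    have "fst z - f z = (1/2) *\<^sub>R (fst z - snd z)" for z
      unfolding f_def by (simp add: algebra_simps flip: scaleR_left.add)
    then have "norm (fst z - f z) = norm (fst z - snd z) / 2" for z
      by simp
    from cost[of fst, OF this]
    show "transport_cost (distr \<pi> (borel \<Otimes>\<^sub>M borel) (\<lambda>z. (fst z, f z))) \<le> ennreal (c\<^sup>2)"
      by (simp add: transport_cost_distr)
  qed
  moreover have "W2 \<nu> m \<le> c"
  proof (rule W2_le[OF _ _ c])
    show "distr \<pi> (borel \<Otimes>\<^sub>M borel) (\<lambda>z. (snd z, f z)) \<in> couplings \<nu> m"
      using couplingsD[OF \<pi>(1)] by (intro couplings_distrI) (auto simp: m_def)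
    have "snd z - f z = (1/2) *\<^sub>R (snd z - fst z)" for z
      unfolding f_def by (simp add: algebra_simps flip: scaleR_left.add)
    then have "norm (snd z - f z) = norm (fst z - snd z) / 2" for z
      by (simp add: norm_minus_commute)
    from cost[of snd, OF this]
    show "transport_cost (distr \<pi> (borel \<Otimes>\<^sub>M borel) (\<lambda>z. (snd z, f z))) \<le> ennreal (c\<^sup>2)"
      by (simp add: transport_cost_distr)
  qed
  ultimately show ?thesis using \<open>m \<in> P2\<close> unfolding c_def by blast
qed

lemma second_moment_le:
  assumes "\<mu> \<in> P2" "\<nu> \<in> P2"
  shows "(\<integral>\<^sup>+ x. ennreal ((norm x)\<^sup>2) \<partial>\<mu>) \<le> ennreal (2 * (W2 \<mu> \<nu> + 1)\<^sup>2) + 2 * (\<integral>\<^sup>+ x. ennreal ((norm x)\<^sup>2) \<partial>\<nu>)"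
proof -
  obtain \<pi> where \<pi>: "\<pi> \<in> couplings \<mu> \<nu>" "transport_cost \<pi> \<le> ennreal ((W2 \<mu> \<nu> + 1)\<^sup>2)"
    using W2_approx[OF assms, of 1] by auto
  note meas[measurable] = couplingsD(4,5)[OF \<pi>(1)]
  have "(\<integral>\<^sup>+ x. ennreal ((norm x)\<^sup>2) \<partial>\<mu>) = (\<integral>\<^sup>+ z. ennreal ((norm (fst z))\<^sup>2) \<partial>\<pi>)"
    by (simp add: nn_integral_coupling[OF \<pi>(1), where f = "\<lambda>x. ennreal ((norm x)\<^sup>2)"])
  also have "\<dots> \<le> (\<integral>\<^sup>+ z. 2 * ennreal ((norm (fst z - snd z))\<^sup>2) + 2 * ennreal ((norm (snd z))\<^sup>2) \<partial>\<pi>)"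
  proof (intro nn_integral_mono)
    fix z :: "'a \<times> 'a"
    have "(norm (fst z))\<^sup>2 \<le> 2 * (norm (fst z - snd z))\<^sup>2 + 2 * (norm (snd z))\<^sup>2"
      using norm_diff_sq_le[of "fst z - snd z" "- snd z"] by simp
    then show "ennreal ((norm (fst z))\<^sup>2) \<le> 2 * ennreal ((norm (fst z - snd z))\<^sup>2) + 2 * ennreal ((norm (snd z))\<^sup>2)"
      by (auto simp: ennreal_plus[symmetric] ennreal_mult'[symmetric] simp flip: ennreal_numeral simp del: ennreal_plus)
  qed
  also have "\<dots> = 2 * transport_cost \<pi> + 2 * (\<integral>\<^sup>+ z. ennreal ((norm (snd z))\<^sup>2) \<partial>\<pi>)"
    by (subst nn_integral_add) (auto simp: nn_integral_cmult)
  also have "\<dots> \<le> 2 * ennreal ((W2 \<mu> \<nu> + 1)\<^sup>2) + 2 * (\<integral>\<^sup>+ x. ennreal ((norm x)\<^sup>2) \<partial>\<nu>)"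
    using \<pi>(2) by (simp add: nn_integral_coupling[OF \<pi>(1), where f = "\<lambda>x. ennreal ((norm x)\<^sup>2)"] mult_left_mono)
  also have "2 * ennreal ((W2 \<mu> \<nu> + 1)\<^sup>2) = ennreal (2 * (W2 \<mu> \<nu> + 1)\<^sup>2)"
    by (simp add: ennreal_mult')
  finally show ?thesis .
qed

section \<open>Gluing of couplings\<close>

lemma ex_small_cells:
  assumes "0 < e"
  obtains q :: "'a::euclidean_space \<Rightarrow> nat" where
    "q \<in> measurable borel (count_space UNIV)" "\<And>x y. q x = q y \<Longrightarrow> dist x y \<le> e"
proof -
  obtain D :: "'a set" where D: "countable D" "\<And>X. open X \<Longrightarrow> X \<noteq> {} \<Longrightarrow> \<exists>d\<in>D. d \<in> X"
    using countable_dense_setE by blast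
  have ne: "D \<noteq> {}" using D(2)[of UNIV] by auto
  define c where "c = from_nat_into D"
  define q where "q x = (LEAST n. dist x (c n) < e / 2)" for x
  have q: "dist x (c (q x)) < e / 2" for x
  proof -
    obtain y where "y \<in> D" "y \<in> ball x (e / 2)"
      using D(2)[of "ball x (e / 2)"] assms by auto
    moreover obtain n where "c n = y"
      using range_from_nat_into[OF ne D(1)] \<open>y \<in> D\<close> unfolding c_def by (metis imageE)
    ultimately have "dist x (c n) < e / 2" by simp
    then show ?thesis unfolding q_def by (rule LeastI)
  qed
  have "q \<in> measurable borel (count_space UNIV)"
    unfolding q_def by measurable
  moreover have "dist x y \<le> e" if "q x = q y" for x y
    using q[of x] q[of y] that dist_triangle_half_r[of "c (q y)" x e y] by (simp add: dist_commute)
  ultimately show ?thesis using that by blast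
qed

text \<open>Two-term Cauchy-Schwarz in Engel form.\<close>

lemma power2_sum_div_le:
  fixes x y A B :: real
  assumes "0 < A" "0 < B"
  shows "(x + y)\<^sup>2 / (A + B) \<le> x\<^sup>2 / A + y\<^sup>2 / B"
proof -
  have "0 \<le> (B * x - A * y)\<^sup>2" by simp
  then have "(x + y)\<^sup>2 * (A * B) \<le> (x\<^sup>2 * B + y\<^sup>2 * A) * (A + B)"
    by (simp add: power2_eq_square algebra_simps)
  then show ?thesis using assms by (simp add: field_simps add_pos_pos)
qed

lemma norm_diff_sq_three_le:
  fixes x y y' z :: "'a::real_normed_vector"
  assumes "0 < A" "0 < B" "0 < e" "norm (y - y') \<le> e"
  shows "(norm (x - z))\<^sup>2 \<le> (A + B + e) / A * (norm (x - y))\<^sup>2 + (A + B + e) / B * (norm (y' - z))\<^sup>2 + (A + B + e) * e"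
proof -
  let ?S = "A + B + e"
  have "norm (x - z) \<le> norm (x - y) + norm (y' - z) + norm (y - y')"
    using norm_triangle_ineq[of "x - y" "y - y'"] norm_triangle_ineq[of "x - y'" "y' - z"] by simp
  also have "\<dots> \<le> norm (x - y) + norm (y' - z) + e" using assms by simp
  finally have "(norm (x - z))\<^sup>2 \<le> (norm (x - y) + norm (y' - z) + e)\<^sup>2"
    by (intro power_mono) auto
  moreover have "(norm (x - y) + norm (y' - z) + e)\<^sup>2 / ?S \<le> (norm (x - y) + norm (y' - z))\<^sup>2 / (A + B) + e\<^sup>2 / e"
    using assms by (intro power2_sum_div_le) auto
  moreover have "(norm (x - y) + norm (y' - z))\<^sup>2 / (A + B) \<le> (norm (x - y))\<^sup>2 / A + (norm (y' - z))\<^sup>2 / B"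
    using assms by (intro power2_sum_div_le) auto
  moreover have "e\<^sup>2 / e = e" by (simp add: power2_eq_square)
  moreover have "0 < ?S" using assms by simp
  ultimately have "(norm (x - z))\<^sup>2 / ?S \<le> (norm (x - y))\<^sup>2 / A + (norm (y' - z))\<^sup>2 / B + e"
    by (smt (verit) divide_right_mono)
  then have "(norm (x - z))\<^sup>2 \<le> ((norm (x - y))\<^sup>2 / A + (norm (y' - z))\<^sup>2 / B + e) * ?S"
    using \<open>0 < ?S\<close> by (simp add: pos_divide_le_eq)
  then show ?thesis by (simp add: algebra_simps)
qed

text \<open>
  The triangle inequality needs a joint law with given couplings as marginals. Instead of
  disintegrating along \<open>\<nu>\<close>, space is cut into countably many cells of diameter at most \<open>e\<close>, indexed by
  \<open>q\<close>, and the two couplings are taken conditionally independent given the cell of the middle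
  point. This law is the product of the couplings with the explicit density \<open>k\<close>. It has the right marginals, and
  its two middle points share a cell, which costs at most an additional \<open>e\<close>. The Minkowski inequality
  is replaced by the pointwise weighted bound \<open>norm_diff_sq_three_le\<close>, whose weights are chosen to
  integrate to exactly \<open>(A + B + e)\<^sup>2\<close>.
\<close>

lemma W2_glue:
  fixes \<mu> \<nu> \<omega> :: "'a::euclidean_space measure"
  assumes P: "\<mu> \<in> P2" "\<nu> \<in> P2" "\<omega> \<in> P2"
    and \<pi>1: "\<pi>1 \<in> couplings \<mu> \<nu>" "transport_cost \<pi>1 \<le> ennreal (A\<^sup>2)"
    and \<pi>2: "\<pi>2 \<in> couplings \<nu> \<omega>" "transport_cost \<pi>2 \<le> ennreal (B\<^sup>2)"
    and pos: "0 < A" "0 < B" "0 < e"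
  shows "W2 \<mu> \<omega> \<le> A + B + e"
proof -
  obtain q :: "'a \<Rightarrow> nat" where q[measurable]: "q \<in> measurable borel (count_space UNIV)"
    and cell: "\<And>x y. q x = q y \<Longrightarrow> dist x y \<le> e"
    using ex_small_cells[OF pos(3)] by blast
  interpret \<nu>: prob_space \<nu> using P by (simp add: P2_iff)
  interpret \<pi>1: prob_space \<pi>1
    using prob_space_coupling[OF \<pi>1(1)] P by (simp add: P2_iff)
  interpret \<pi>2: prob_space \<pi>2
    using prob_space_coupling[OF \<pi>2(1)] P by (simp add: P2_iff)
  interpret pair: pair_prob_space \<pi>1 \<pi>2 ..
  note [measurable_cong] = couplingsD(1)[OF \<pi>1(1)] couplingsD(1)[OF \<pi>2(1)]
  have \<nu>_sets[measurable_cong]: "sets \<nu> = sets borel" using P by (simp add: P2_iff)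
  define N where "N n = emeasure \<nu> {y. q y = n}" for n
  have N_le: "N n \<noteq> \<infinity>" for n by (simp add: N_def)
  have cellsets[measurable]: "{y. q y = n} \<in> sets borel" for n by measurable
  have N_pos: "AE y in \<nu>. N (q y) \<noteq> 0"
  proof -
    have "AE y in \<nu>. \<forall>n. N n = 0 \<longrightarrow> q y \<noteq> n"
    proof (subst AE_all_countable, intro allI)
      fix n
      show "AE y in \<nu>. N n = 0 \<longrightarrow> q y \<noteq> n"
      proof (cases "N n = 0")
        case True
        then have "{y. q y = n} \<in> null_sets \<nu>" by (auto simp: N_def null_sets_def \<nu>_sets)
        then have "AE y in \<nu>. y \<notin> {y. q y = n}" by (rule AE_not_in)
        then show ?thesis by simp
      qed simp
    qed
    then show ?thesis by (rule AE_mp) auto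
  qed
  \<comment> \<open>cells of measure zero give the value \<open>\<infinity>\<close>, but almost surely they are not visited\<close>
  define k :: "('a \<times> 'a) \<Rightarrow> ('a \<times> 'a) \<Rightarrow> ennreal"
    where "k z w = (if q (snd z) = q (fst w) then 1 / N (q (snd z)) else 0)" for z w
  have k_meas[measurable]: "(\<lambda>(z, w). k z w) \<in> borel_measurable (\<pi>1 \<Otimes>\<^sub>M \<pi>2)"
  proof -
    have [measurable]: "(\<lambda>y. 1 / N (q y)) \<in> borel_measurable borel"
      by (rule measurable_compose[OF q]) simp
    have "(\<lambda>(z, w). k z w) = (\<lambda>p. if \<exists>n. q (snd (fst p)) = n \<and> q (fst (snd p)) = n
        then 1 / N (q (snd (fst p))) else 0)"
      by (auto simp: k_def fun_eq_iff)
    also have "\<dots> \<in> borel_measurable (\<pi>1 \<Otimes>\<^sub>M \<pi>2)"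
      by measurable
    finally show ?thesis .
  qed
  have k_int1: "AE z in \<pi>1. (\<integral>\<^sup>+ w. k z w \<partial>\<pi>2) = 1"
  proof -
    have "AE z in \<pi>1. N (q (snd z)) \<noteq> 0"
      using N_pos by (rule AE_distrD[OF couplingsD(5)[OF \<pi>1(1)], unfolded couplingsD(3)[OF \<pi>1(1)]])
    then show ?thesis
    proof eventually_elim
      case (elim z)
      have "(\<integral>\<^sup>+ w. k z w \<partial>\<pi>2) = (\<integral>\<^sup>+ w. 1 / N (q (snd z)) * indicator {y. q y = q (snd z)} (fst w) \<partial>\<pi>2)"
        by (intro nn_integral_cong) (auto simp: k_def indicator_def)
      also have "\<dots> = 1 / N (q (snd z)) * N (q (snd z))"
        using nn_integral_coupling(1)[OF \<pi>2(1), of "indicator {y. q y = q (snd z)}"]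
        by (subst nn_integral_cmult) (auto simp: N_def)
      also have "\<dots> = 1" using elim N_le by (simp add: ennreal_divide_times ennreal_divide_self top.not_eq_extremum)
      finally show ?case .
    qed
  qed
  have k_int2: "AE w in \<pi>2. (\<integral>\<^sup>+ z. k z w \<partial>\<pi>1) = 1"
  proof -
    have "AE w in \<pi>2. N (q (fst w)) \<noteq> 0"
      using N_pos by (rule AE_distrD[OF couplingsD(4)[OF \<pi>2(1)], unfolded couplingsD(2)[OF \<pi>2(1)]])
    then show ?thesis
    proof eventually_elim
      case (elim w)
      have "(\<integral>\<^sup>+ z. k z w \<partial>\<pi>1) = (\<integral>\<^sup>+ z. 1 / N (q (fst w)) * indicator {y. q y = q (fst w)} (snd z) \<partial>\<pi>1)"
        by (intro nn_integral_cong) (auto simp: k_def indicator_def)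
      also have "\<dots> = 1 / N (q (fst w)) * N (q (fst w))"
        using nn_integral_coupling(2)[OF \<pi>1(1), of "indicator {y. q y = q (fst w)}"]
        by (subst nn_integral_cmult) (auto simp: N_def)
      also have "\<dots> = 1" using elim N_le by (simp add: ennreal_divide_times ennreal_divide_self top.not_eq_extremum)
      finally show ?case .
    qed
  qed
  define \<theta> where "\<theta> = density (\<pi>1 \<Otimes>\<^sub>M \<pi>2) (\<lambda>(z, w). k z w)"
  have int1: "(\<integral>\<^sup>+ p. f (fst p) \<partial>\<theta>) = (\<integral>\<^sup>+ z. f z \<partial>\<pi>1)" if [measurable]: "f \<in> borel_measurable \<pi>1" for f
  proof -
    have "(\<integral>\<^sup>+ p. f (fst p) \<partial>\<theta>) = (\<integral>\<^sup>+ p. (case p of (z, w) \<Rightarrow> k z w * f z) \<partial>(\<pi>1 \<Otimes>\<^sub>M \<pi>2))"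
      unfolding \<theta>_def by (subst nn_integral_density) (auto intro!: nn_integral_cong)
    also have "\<dots> = (\<integral>\<^sup>+ z. (\<integral>\<^sup>+ w. k z w * f z \<partial>\<pi>2) \<partial>\<pi>1)"
      by (subst \<pi>2.nn_integral_fst[symmetric]) auto
    also have "\<dots> = (\<integral>\<^sup>+ z. (\<integral>\<^sup>+ w. k z w \<partial>\<pi>2) * f z \<partial>\<pi>1)"
      by (intro nn_integral_cong nn_integral_multc) simp
    also have "\<dots> = (\<integral>\<^sup>+ z. f z \<partial>\<pi>1)"
      using k_int1 by (intro nn_integral_cong_AE) auto
    finally show ?thesis .
  qed
  have int2: "(\<integral>\<^sup>+ p. f (snd p) \<partial>\<theta>) = (\<integral>\<^sup>+ w. f w \<partial>\<pi>2)" if [measurable]: "f \<in> borel_measurable \<pi>2" for f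
  proof -
    have "(\<integral>\<^sup>+ p. f (snd p) \<partial>\<theta>) = (\<integral>\<^sup>+ p. (case p of (z, w) \<Rightarrow> k z w * f w) \<partial>(\<pi>1 \<Otimes>\<^sub>M \<pi>2))"
      unfolding \<theta>_def by (subst nn_integral_density) (auto intro!: nn_integral_cong)
    also have "\<dots> = (\<integral>\<^sup>+ w. (\<integral>\<^sup>+ z. k z w * f w \<partial>\<pi>1) \<partial>\<pi>2)"
      by (subst pair.nn_integral_snd[symmetric]) auto
    also have "\<dots> = (\<integral>\<^sup>+ w. (\<integral>\<^sup>+ z. k z w \<partial>\<pi>1) * f w \<partial>\<pi>2)"
      by (intro nn_integral_cong nn_integral_multc) simp
    also have "\<dots> = (\<integral>\<^sup>+ w. f w \<partial>\<pi>2)"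
      using k_int2 by (intro nn_integral_cong_AE) auto
    finally show ?thesis .
  qed
  have \<theta>_sets[measurable_cong]: "sets \<theta> = sets (\<pi>1 \<Otimes>\<^sub>M \<pi>2)" by (simp add: \<theta>_def)
  note [measurable] = couplingsD(4,5)[OF \<pi>1(1)] couplingsD(4,5)[OF \<pi>2(1)]
  have marg1: "distr \<theta> borel (\<lambda>p. fst (fst p)) = \<mu>"
  proof (rule measure_eqI)
    fix X assume "X \<in> sets (distr \<theta> borel (\<lambda>p. fst (fst p)))"
    then have [measurable]: "X \<in> sets borel" by simp
    have "emeasure (distr \<theta> borel (\<lambda>p. fst (fst p))) X = (\<integral>\<^sup>+ x. indicator X x \<partial>(distr \<theta> borel (\<lambda>p. fst (fst p))))"
      by simp
    also have "\<dots> = (\<integral>\<^sup>+ p. indicator X (fst (fst p)) \<partial>\<theta>)"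
      by (rule nn_integral_distr) measurable
    also have "\<dots> = (\<integral>\<^sup>+ z. indicator X (fst z) \<partial>\<pi>1)"
      by (rule int1[of "\<lambda>z. indicator X (fst z)"]) measurable
    also have "\<dots> = (\<integral>\<^sup>+ x. indicator X x \<partial>\<mu>)"
      by (rule nn_integral_coupling(1)[OF \<pi>1(1)]) measurable
    also have "\<dots> = emeasure \<mu> X" using P by (simp add: P2_iff)
    finally show "emeasure (distr \<theta> borel (\<lambda>p. fst (fst p))) X = emeasure \<mu> X" .
  qed (use P in \<open>simp add: P2_iff\<close>)
  have marg2: "distr \<theta> borel (\<lambda>p. snd (snd p)) = \<omega>"
  proof (rule measure_eqI)
    fix X assume "X \<in> sets (distr \<theta> borel (\<lambda>p. snd (snd p)))"
    then have [measurable]: "X \<in> sets borel" by simp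
    have "emeasure (distr \<theta> borel (\<lambda>p. snd (snd p))) X = (\<integral>\<^sup>+ x. indicator X x \<partial>(distr \<theta> borel (\<lambda>p. snd (snd p))))"
      by simp
    also have "\<dots> = (\<integral>\<^sup>+ p. indicator X (snd (snd p)) \<partial>\<theta>)"
      by (rule nn_integral_distr) measurable
    also have "\<dots> = (\<integral>\<^sup>+ z. indicator X (snd z) \<partial>\<pi>2)"
      by (rule int2[of "\<lambda>z. indicator X (snd z)"]) measurable
    also have "\<dots> = (\<integral>\<^sup>+ x. indicator X x \<partial>\<omega>)"
      by (rule nn_integral_coupling(2)[OF \<pi>2(1)]) measurable
    also have "\<dots> = emeasure \<omega> X" using P by (simp add: P2_iff)
    finally show "emeasure (distr \<theta> borel (\<lambda>p. snd (snd p))) X = emeasure \<omega> X" .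
  qed (use P in \<open>simp add: P2_iff\<close>)
  let ?S = "A + B + e"
  show ?thesis
  proof (rule W2_le)
    show "distr \<theta> (borel \<Otimes>\<^sub>M borel) (\<lambda>p. (fst (fst p), snd (snd p))) \<in> couplings \<mu> \<omega>"
      by (intro couplings_distrI marg1 marg2) measurable
    have "transport_cost (distr \<theta> (borel \<Otimes>\<^sub>M borel) (\<lambda>p. (fst (fst p), snd (snd p))))
        = (\<integral>\<^sup>+ p. ennreal ((norm (fst (fst p) - snd (snd p)))\<^sup>2) \<partial>\<theta>)"
      by (rule transport_cost_distr) measurable
    also have "\<dots> \<le> (\<integral>\<^sup>+ p. ennreal (?S / A) * ennreal ((norm (fst (fst p) - snd (fst p)))\<^sup>2)
        + ennreal (?S / B) * ennreal ((norm (fst (snd p) - snd (snd p)))\<^sup>2) + ennreal (?S * e) \<partial>\<theta>)"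
    proof (rule nn_integral_mono_AE)
      have "AE p in \<theta>. q (snd (fst p)) = q (fst (snd p))"
        unfolding \<theta>_def by (subst AE_density) (auto simp: k_def split: if_splits intro!: AE_I2)
      then show "AE p in \<theta>. ennreal ((norm (fst (fst p) - snd (snd p)))\<^sup>2) \<le> ennreal (?S / A) * ennreal ((norm (fst (fst p) - snd (fst p)))\<^sup>2)
        + ennreal (?S / B) * ennreal ((norm (fst (snd p) - snd (snd p)))\<^sup>2) + ennreal (?S * e)"
      proof eventually_elim
        case (elim p)
        then have "norm (snd (fst p) - fst (snd p)) \<le> e" using cell by (simp add: dist_norm)
        from norm_diff_sq_three_le[OF pos this, of "fst (fst p)" "snd (snd p)"]
        have "ennreal ((norm (fst (fst p) - snd (snd p)))\<^sup>2)
            \<le> ennreal (?S / A * (norm (fst (fst p) - snd (fst p)))\<^sup>2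
              + ?S / B * (norm (fst (snd p) - snd (snd p)))\<^sup>2 + ?S * e)"
          by (rule ennreal_leI)
        also have "\<dots> = ennreal (?S / A) * ennreal ((norm (fst (fst p) - snd (fst p)))\<^sup>2)
            + ennreal (?S / B) * ennreal ((norm (fst (snd p) - snd (snd p)))\<^sup>2) + ennreal (?S * e)"
          using pos by (simp only: ennreal_plus ennreal_mult zero_le_power2 mult_nonneg_nonneg
              divide_nonneg_nonneg add_nonneg_nonneg less_imp_le)
        finally show ?case .
      qed
    qed
    also have "\<dots> = ennreal (?S / A) * transport_cost \<pi>1 + ennreal (?S / B) * transport_cost \<pi>2 + ennreal (?S * e)"
    proof -
      have one: "(\<integral>\<^sup>+ p. ennreal (?S * e) \<partial>\<theta>) = ennreal (?S * e)"
        using int1[of "\<lambda>_. ennreal (?S * e)"] by (simp add: \<pi>1.emeasure_space_1)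
      have "(\<integral>\<^sup>+ p. ennreal ((norm (fst (fst p) - snd (fst p)))\<^sup>2) \<partial>\<theta>) = transport_cost \<pi>1"
        by (rule int1[of "\<lambda>z. ennreal ((norm (fst z - snd z))\<^sup>2)"]) measurable
      moreover have "(\<integral>\<^sup>+ p. ennreal ((norm (fst (snd p) - snd (snd p)))\<^sup>2) \<partial>\<theta>) = transport_cost \<pi>2"
        by (rule int2[of "\<lambda>z. ennreal ((norm (fst z - snd z))\<^sup>2)"]) measurable
      ultimately show ?thesis
        using one by (subst nn_integral_add, simp, simp, subst nn_integral_add, simp, simp)
           (simp add: nn_integral_cmult)
    qed
    also have "\<dots> \<le> ennreal (?S / A) * ennreal (A\<^sup>2) + ennreal (?S / B) * ennreal (B\<^sup>2) + ennreal (?S * e)"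
      by (intro add_mono mult_left_mono \<pi>1(2) \<pi>2(2)) auto
    also have "\<dots> = ennreal (?S / A * A\<^sup>2 + ?S / B * B\<^sup>2 + ?S * e)"
      using pos by (simp add: ennreal_mult'[symmetric] ennreal_plus[symmetric] del: ennreal_plus)
    also have "?S / A * A\<^sup>2 + ?S / B * B\<^sup>2 + ?S * e = ?S\<^sup>2"
    proof -
      have "?S / A * A\<^sup>2 = ?S * A" "?S / B * B\<^sup>2 = ?S * B"
        using pos by (simp_all add: power2_eq_square)
      then show ?thesis by (simp add: power2_eq_square distrib_left)
    qed
    finally show "transport_cost (distr \<theta> (borel \<Otimes>\<^sub>M borel) (\<lambda>p. (fst (fst p), snd (snd p)))) \<le> ennreal (?S\<^sup>2)" .
  qed (use pos in simp)
qed

lemma W2_triangle: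
  fixes \<mu> \<nu> \<omega> :: "'a::euclidean_space measure"
  assumes "\<mu> \<in> P2" "\<nu> \<in> P2" "\<omega> \<in> P2"
  shows "W2 \<mu> \<omega> \<le> W2 \<mu> \<nu> + W2 \<nu> \<omega>"
proof (rule field_le_epsilon)
  fix \<epsilon> :: real assume "0 < \<epsilon>"
  then have e: "0 < \<epsilon> / 3" by simp
  obtain \<pi>1 where \<pi>1: "\<pi>1 \<in> couplings \<mu> \<nu>" "transport_cost \<pi>1 \<le> ennreal ((W2 \<mu> \<nu> + \<epsilon> / 3)\<^sup>2)"
    using W2_approx[OF assms(1,2) e] by blast
  obtain \<pi>2 where \<pi>2: "\<pi>2 \<in> couplings \<nu> \<omega>" "transport_cost \<pi>2 \<le> ennreal ((W2 \<nu> \<omega> + \<epsilon> / 3)\<^sup>2)"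
    using W2_approx[OF assms(2,3) e] by blast
  have "W2 \<mu> \<omega> \<le> (W2 \<mu> \<nu> + \<epsilon> / 3) + (W2 \<nu> \<omega> + \<epsilon> / 3) + \<epsilon> / 3"
    using e by (intro W2_glue[OF assms \<pi>1 \<pi>2]) (auto intro!: add_nonneg_pos W2_nonneg)
  then show "W2 \<mu> \<omega> \<le> W2 \<mu> \<nu> + W2 \<nu> \<omega> + \<epsilon>" by simp
qed

section \<open>Lower bound of the energy\<close>

text \<open>
  Near \<open>0\<close> the growth condition gives a bound by a power; away from \<open>0\<close> convexity and \<open>F 0 = 0\<close> give a
  linear one. The exponent is lowered below \<open>1\<close> if necessary, because only then can the power be
  interpolated as in \<open>powr_le_moment_plus_tail\<close>.
\<close>

lemma internal_energy_density_lower_bound: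
  assumes "internal_energy_density n F"
  obtains \<alpha> C where "real n / (real n + 2) < \<alpha>" "\<alpha> < 1" "0 \<le> C"
    "\<And>z. 0 \<le> z \<Longrightarrow> - F z \<le> C * (z + z powr \<alpha>)"
proof -
  have F: "convex_on {0..} F" "F 0 = 0" using assms by (auto simp: internal_energy_density_def)
  obtain \<beta> L where \<beta>: "real n / (real n + 2) < \<beta>" and L: "L > -\<infinity>"
    "((\<lambda>s. ereal (F s / s powr \<beta>)) \<longlongrightarrow> L) (at_right 0)"
    using assms unfolding internal_energy_density_def by blast
  obtain l :: real where l: "ereal l < L" using L(1) by (metis ereal_dense2 ereal_infty_less(2) less_ereal.simps(5) MInfty_neq_PInfty(1))
  have "\<forall>\<^sub>F s in at_right 0. ereal l < ereal (F s / s powr \<beta>)"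
    using L(2) l by (rule order_tendstoD)
  then obtain s1 where s1: "0 < s1" "\<And>s. 0 < s \<Longrightarrow> s < s1 \<Longrightarrow> l < F s / s powr \<beta>"
    unfolding eventually_at_right_field by auto
  define c where "c = real n / (real n + 2)"
  have "c < 1" by (simp add: c_def)
  define \<alpha> where "\<alpha> = min \<beta> ((c + 1) / 2)"
  have \<alpha>: "c < \<alpha>" "\<alpha> < 1" "\<alpha> \<le> \<beta>"
    using \<beta> \<open>c < 1\<close> by (auto simp: \<alpha>_def c_def[symmetric] min_less_iff_disj)
  define s0 where "s0 = min 1 (s1 / 2)"
  have s0: "0 < s0" "s0 \<le> 1" "s0 < s1" using s1(1) by (auto simp: s0_def min_less_iff_disj)
  define C where "C = \<bar>l\<bar> + \<bar>F s0\<bar> / s0"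
  have C: "0 \<le> C" "\<bar>l\<bar> \<le> C" "\<bar>F s0\<bar> / s0 \<le> C" using s0 by (auto simp: C_def)
  have "- F z \<le> C * (z + z powr \<alpha>)" if z: "0 \<le> z" for z
  proof -
    consider "z = 0" | "0 < z" "z \<le> s0" | "s0 < z" using z by linarith
    then show ?thesis
    proof cases
      case 1
      then show ?thesis using F(2) by simp
    next
      case 2
      then have "l < F z / z powr \<beta>" using s1(2) s0 by simp
      then have "l * z powr \<beta> < F z" using 2 by (simp add: field_simps)
      then have "- F z \<le> - l * z powr \<beta>" by simp
      also have "\<dots> \<le> \<bar>l\<bar> * z powr \<beta>" by (intro mult_right_mono) auto
      also have "\<dots> \<le> C * z powr \<alpha>"
        using 2 s0 \<alpha> C by (intro mult_mono powr_mono') auto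
      also have "\<dots> \<le> C * (z + z powr \<alpha>)" using C 2 by (intro mult_left_mono) auto
      finally show ?thesis .
    next
      case 3
      \<comment> \<open>convexity through the origin makes \<open>F z / z\<close> nondecreasing\<close>
      define t where "t = s0 / z"
      have t: "0 < t" "t \<le> 1" "t * z = s0" using 3 s0 by (auto simp: t_def)
      have "F ((1 - t) *\<^sub>R 0 + t *\<^sub>R z) \<le> (1 - t) * F 0 + t * F z"
        using t 3 s0 by (intro convex_onD[OF F(1)]) auto
      then have "F s0 \<le> t * F z" using t F(2) by simp
      then have "F s0 / t \<le> F z" using t by (simp add: field_simps)
      moreover have "F s0 / t = F s0 / s0 * z" using s0 3 by (simp add: t_def)
      ultimately have "- F z \<le> - (F s0 / s0) * z" by simp
      also have "\<dots> \<le> (\<bar>F s0\<bar> / s0) * z"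
        using s0 3 by (intro mult_right_mono) (auto simp: field_simps)
      also have "\<dots> \<le> C * (z + z powr \<alpha>)"
        using C s0 3 by (intro mult_mono) auto
      finally show ?thesis .
    qed
  qed
  then show ?thesis using that \<alpha> C(1) unfolding c_def by blast
qed

text \<open>
  On dyadic annuli the integrand is at most \<open>2 powr (- 2 * q * n)\<close> while the volume grows like
  \<open>2 powr (n * DIM('a))\<close>, so a geometric series dominates.
\<close>

lemma nn_integral_inverse_power_finite:
  assumes q: "real DIM('a) < 2 * q"
  shows "(\<integral>\<^sup>+ x. ennreal ((1 + (norm (x :: 'a::euclidean_space))\<^sup>2) powr (- q)) \<partial>lborel) < \<infinity>"
proof -
  define d where "d = real DIM('a)"
  have "0 \<le> d" by (simp add: d_def)
  then have "0 < q" using q by (simp add: d_def)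
  define g where "g n = ennreal ((2 powr (- 2 * q)) ^ n)" for n :: nat
  define r where "r = 2 powr (d - 2 * q)"
  have r: "0 < r" "r < 1" using q by (auto simp: r_def d_def powr_less_one)
  have bound: "ennreal ((1 + (norm x)\<^sup>2) powr (- q)) \<le> (\<Sum>n. g n * indicator (ball (0::'a) (2 ^ Suc n)) x)" for x :: 'a
  proof -
    have "\<exists>n. norm x < 2 ^ Suc n \<and> (1 + (norm x)\<^sup>2) powr (- q) \<le> (2 powr (- 2 * q)) ^ n"
    proof (cases "norm x < 2")
      case True
      have "(1 + (norm x)\<^sup>2) powr (- q) \<le> 1 powr (- q)"
        using \<open>0 < q\<close> by (intro powr_mono2') auto
      then show ?thesis using True by (intro exI[of _ 0]) simp
    next
      case False
      define m where "m = (LEAST m. norm x < 2 ^ m)"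
      obtain m' where "norm x < 2 ^ m'" using real_arch_pow[of 2 "norm x"] by auto
      then have m: "norm x < 2 ^ m" unfolding m_def by (rule LeastI)
      have "m \<noteq> 0" using m False by (intro notI) simp
      then obtain n where n: "m = Suc n" by (cases m) auto
      then have "2 ^ n \<le> norm x" using not_less_Least[of n "\<lambda>m. norm x < 2 ^ m"] by (auto simp: m_def)
      then have "(2 ^ n)\<^sup>2 \<le> (norm x)\<^sup>2" by (rule power_mono) simp
      then have "(2 ^ n)\<^sup>2 \<le> 1 + (norm x)\<^sup>2" by linarith
      then have "(1 + (norm x)\<^sup>2) powr (- q) \<le> ((2 ^ n)\<^sup>2) powr (- q)"
        using \<open>0 < q\<close> by (intro powr_mono2') auto
      also have "\<dots> = (2 powr (- 2 * q)) ^ n"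
        by (simp add: powr_powr powr_realpow[symmetric] power_mult[symmetric] mult_ac)
      finally show ?thesis using m n by blast
    qed
    then obtain n where n: "norm x < 2 ^ Suc n" "(1 + (norm x)\<^sup>2) powr (- q) \<le> (2 powr (- 2 * q)) ^ n" by blast
    have "ennreal ((1 + (norm x)\<^sup>2) powr (- q)) \<le> g n * indicator (ball (0::'a) (2 ^ Suc n)) x"
      using n by (auto simp: g_def indicator_def intro!: ennreal_leI)
    also have "\<dots> \<le> (\<Sum>n. g n * indicator (ball (0::'a) (2 ^ Suc n)) x)"
      using sum_le_suminf[of "\<lambda>n. g n * indicator (ball (0::'a) (2 ^ Suc n)) x" "{n}"]
      by (simp only: sum.insert sum.empty finite.intros empty_iff add_0_right zero_le summableI simp_thms)
    finally show ?thesis .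
  qed
  have term_eq: "(\<integral>\<^sup>+ x. g n * indicator (ball (0::'a) (2 ^ Suc n)) x \<partial>lborel)
      = ennreal (unit_ball_vol d * 2 powr d) * ennreal (r ^ n)" for n
  proof -
    have "(\<integral>\<^sup>+ x. g n * indicator (ball (0::'a) (2 ^ Suc n)) x \<partial>lborel) = g n * emeasure lborel (ball (0::'a) (2 ^ Suc n))"
      by (rule nn_integral_cmult_indicator) simp
    also have "\<dots> = g n * ennreal (unit_ball_vol d * (2 ^ Suc n) ^ DIM('a))"
      by (subst emeasure_ball) (auto simp: d_def)
    also have "\<dots> = ennreal ((2 powr (- 2 * q)) ^ n * (unit_ball_vol d * (2 ^ Suc n) ^ DIM('a)))"
      unfolding g_def by (rule ennreal_mult'[symmetric]) simp
    also have "(2 ^ Suc n :: real) ^ DIM('a) = 2 powr d * (2 powr d) ^ n"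
      by (simp add: d_def powr_realpow power_mult_distrib power_mult[symmetric] mult.commute)
    also have "(2 powr (- 2 * q)) ^ n * (unit_ball_vol d * (2 powr d * (2 powr d) ^ n))
        = (unit_ball_vol d * 2 powr d) * (2 powr (- 2 * q) * 2 powr d) ^ n"
      by (simp add: power_mult_distrib)
    also have "2 powr (- 2 * q) * 2 powr d = r"
      by (simp add: r_def powr_add[symmetric])
    also have "ennreal (unit_ball_vol d * 2 powr d * r ^ n) = ennreal (unit_ball_vol d * 2 powr d) * ennreal (r ^ n)"
      using r \<open>0 \<le> d\<close> by (intro ennreal_mult) auto
    finally show ?thesis .
  qed
  have "(\<integral>\<^sup>+ x. ennreal ((1 + (norm (x :: 'a))\<^sup>2) powr (- q)) \<partial>lborel)
      \<le> (\<integral>\<^sup>+ x. (\<Sum>n. g n * indicator (ball (0::'a) (2 ^ Suc n)) x) \<partial>lborel)"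
    by (intro nn_integral_mono bound)
  also have "\<dots> = (\<Sum>n. \<integral>\<^sup>+ x. g n * indicator (ball (0::'a) (2 ^ Suc n)) x \<partial>lborel)"
    by (rule nn_integral_suminf) (intro borel_measurable_times_ennreal borel_measurable_indicator; simp)
  also have "\<dots> = ennreal (unit_ball_vol d * 2 powr d) * (\<Sum>n. ennreal (r ^ n))"
    unfolding term_eq by (rule ennreal_suminf_cmult)
  also have "(\<Sum>n. ennreal (r ^ n)) = ennreal (\<Sum>n. r ^ n)"
    using r by (intro suminf_ennreal2 summable_geometric) auto
  also have "ennreal (unit_ball_vol d * 2 powr d) * ennreal (\<Sum>n. r ^ n) < \<infinity>"
    by (simp add: ennreal_mult_less_top)
  finally show ?thesis .
qed

text \<open>
  A pointwise form of the Hoelder estimate of \<open>\<integral> z powr \<alpha>\<close> by the weighted mass \<open>\<integral> z * w\<close>: one of the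
  two terms dominates according to whether \<open>z powr (1 - \<alpha>) * w\<close> is at least \<open>1\<close>.
\<close>

lemma powr_le_moment_plus_tail:
  fixes z w \<alpha> :: real
  assumes "0 \<le> z" "1 \<le> w" "0 < \<alpha>" "\<alpha> < 1"
  shows "z powr \<alpha> \<le> z * w + w powr (- (\<alpha> / (1 - \<alpha>)))"
proof (cases "z = 0")
  case False
  then have z: "0 < z" using assms by simp
  show ?thesis
  proof (cases "1 \<le> z powr (1 - \<alpha>) * w")
    case True
    have "z powr \<alpha> * 1 \<le> z powr \<alpha> * (z powr (1 - \<alpha>) * w)"
      using True by (intro mult_left_mono) auto
    also have "\<dots> = z * w" using z by (simp add: mult.assoc[symmetric] powr_add[symmetric])
    also have "\<dots> \<le> z * w + w powr (- (\<alpha> / (1 - \<alpha>)))" by simp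
    finally show ?thesis by simp
  next
    case False
    then have "z powr (1 - \<alpha>) \<le> w powr (- 1)"
      using assms by (simp add: powr_minus field_simps)
    then have "(z powr (1 - \<alpha>)) powr (\<alpha> / (1 - \<alpha>)) \<le> (w powr (- 1)) powr (\<alpha> / (1 - \<alpha>))"
      using assms by (intro powr_mono2) auto
    then have "z powr \<alpha> \<le> w powr (- (\<alpha> / (1 - \<alpha>)))"
      using assms unfolding powr_powr by simp
    moreover have "0 \<le> z * w" using z assms by simp
    ultimately show ?thesis by linarith
  qed
qed simp

lemma ext_integral_ge:
  assumes "(\<integral>\<^sup>+ x. ennreal (- f x) \<partial>M) \<le> ennreal c" "0 \<le> c"
  shows "ereal (- c) \<le> ext_integral M f"
proof -
  have "enn2ereal (\<integral>\<^sup>+ x. ennreal (- f x) \<partial>M) \<le> ereal c"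
    using assms by (metis enn2ereal_ennreal less_eq_ennreal.rep_eq)
  then have "0 - ereal c \<le> ext_integral M f"
    unfolding ext_integral_def by (intro ereal_minus_mono enn2ereal_nonneg)
  then show ?thesis by simp
qed

text \<open>
  Lower semicontinuity bounds \<open>V\<close> below on a ball around \<open>0\<close>, and convexity along rays from \<open>0\<close> propagates
  the bound outwards.
\<close>

lemma k_convex_lsc_lower_bound:
  fixes V :: "'a::euclidean_space \<Rightarrow> real"
  assumes "k_convex k V" "lsc_on UNIV dist V"
  obtains C where "0 \<le> C" "\<And>x. - V x \<le> C * (1 + (norm x)\<^sup>2)"
proof -
  obtain r where r: "0 < r" "\<And>y. dist 0 y < r \<Longrightarrow> V 0 - 1 < V y"
    using assms(2) unfolding lsc_on_def by (metis UNIV_I zero_less_one)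
  define C where "C = \<bar>V 0\<bar> + 1 + 2 / r + \<bar>k\<bar> / 2"
  have C: "0 \<le> C" using r by (simp add: C_def)
  have "- V x \<le> C * (1 + (norm x)\<^sup>2)" for x
  proof (cases "norm x < r")
    case True
    then have "V 0 - 1 < V x" using r(2)[of x] by simp
    then have "- V x \<le> \<bar>V 0\<bar> + 1" by linarith
    also have "\<dots> \<le> C * 1" using r(1) by (simp add: C_def)
    also have "\<dots> \<le> C * (1 + (norm x)\<^sup>2)" using C by (intro mult_left_mono) auto
    finally show ?thesis .
  next
    case False
    define t where "t = r / (2 * norm x)"
    have nx: "0 < norm x" using False r(1) by linarith
    have t: "0 < t" "t \<le> 1" "t * norm x < r"
      using False r(1) nx by (auto simp: t_def field_simps)
    have "V (t *\<^sub>R x) > V 0 - 1" using r(2)[of "t *\<^sub>R x"] t by simp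
    moreover have "V (t *\<^sub>R x) \<le> (1 - t) * V 0 + t * V x - k / 2 * t * (1 - t) * (norm x)\<^sup>2"
    proof -
      have "V ((1 - t) *\<^sub>R 0 + t *\<^sub>R x) \<le> (1 - t) * V 0 + t * V x - k / 2 * t * (1 - t) * (norm (0 - x))\<^sup>2"
        using assms(1) t unfolding k_convex_def by (metis atLeastAtMost_iff less_imp_le)
      then show ?thesis by simp
    qed
    ultimately have "t * (- V x) \<le> 1 - t * V 0 - k / 2 * t * (1 - t) * (norm x)\<^sup>2"
      by (simp add: algebra_simps)
    also have "\<dots> = t * (1 / t - V 0 - k / 2 * (1 - t) * (norm x)\<^sup>2)"
      using t by (simp add: algebra_simps)
    finally have "- V x \<le> 1 / t - V 0 - k / 2 * (1 - t) * (norm x)\<^sup>2"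
      using t(1) by (simp only: mult_le_cancel_left_pos)
    moreover have "- (k / 2 * (1 - t) * (norm x)\<^sup>2) \<le> \<bar>k\<bar> / 2 * (norm x)\<^sup>2"
    proof -
      have "- (k / 2) * (1 - t) \<le> \<bar>k\<bar> / 2 * (1 - t)" using t by (intro mult_right_mono) auto
      also have "\<dots> \<le> \<bar>k\<bar> / 2 * 1" using t by (intro mult_left_mono) auto
      finally have "(- (k / 2) * (1 - t)) * (norm x)\<^sup>2 \<le> (\<bar>k\<bar> / 2 * 1) * (norm x)\<^sup>2"
        by (rule mult_right_mono) simp
      then show ?thesis by simp
    qed
    moreover have "1 / t = 2 / r * norm x" using r nx by (simp add: t_def)
    moreover have "2 / r * norm x \<le> 2 / r * (1 + (norm x)\<^sup>2)"
    proof (rule mult_left_mono)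
      have "0 \<le> (norm x - 1)\<^sup>2" by simp
      then have "2 * norm x \<le> 1 + (norm x)\<^sup>2" by (simp add: power2_eq_square algebra_simps)
      then show "norm x \<le> 1 + (norm x)\<^sup>2" using nx by linarith
    qed (use r in simp)
    moreover have "C * (1 + (norm x)\<^sup>2) = \<bar>V 0\<bar> + \<bar>V 0\<bar> * (norm x)\<^sup>2 + 1 + (norm x)\<^sup>2 + 2 / r * (1 + (norm x)\<^sup>2) + \<bar>k\<bar> / 2 + \<bar>k\<bar> / 2 * (norm x)\<^sup>2"
      unfolding C_def by (simp add: algebra_simps)
    moreover have "0 \<le> \<bar>V 0\<bar> * (norm x)\<^sup>2" "0 \<le> (norm x)\<^sup>2" "0 \<le> \<bar>k\<bar> / 2" by auto
    ultimately show ?thesis by linarith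
  qed
  then show ?thesis using that C by blast
qed


text \<open>
  With \<open>w = 1 + (norm x)\<^sup>2\<close> the tail exponent is \<open>q = \<alpha> / (1 - \<alpha>)\<close>, and \<open>2 * q > DIM('a)\<close> is equivalent to
  \<open>\<alpha> > DIM('a) / (DIM('a) + 2)\<close>. This is where the growth exponent of \<open>F\<close> at \<open>0\<close> is used.
\<close>

lemma energy_lower_bound:
  fixes F :: "real \<Rightarrow> real" and V W :: "'a::euclidean_space \<Rightarrow> real"
  assumes F: "internal_energy_density DIM('a) F"
    and V: "k_convex k V" "lsc_on UNIV dist V"
    and W: "\<And>x. 0 \<le> W x"
  obtains C where "0 \<le> C"
    "\<And>\<rho> m. \<rho> \<in> P2 \<Longrightarrow> 0 \<le> m \<Longrightarrow> (\<integral>\<^sup>+ x. ennreal ((norm x)\<^sup>2) \<partial>\<rho>) \<le> ennreal m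
      \<Longrightarrow> ereal (- C * (1 + m)) \<le> energy F V W \<rho>"
proof -
  obtain \<alpha> C1 where \<alpha>: "real DIM('a) / (real DIM('a) + 2) < \<alpha>" "\<alpha> < 1" and C1: "0 \<le> C1"
    "\<And>z. 0 \<le> z \<Longrightarrow> - F z \<le> C1 * (z + z powr \<alpha>)"
    using internal_energy_density_lower_bound[OF F] by blast
  obtain C2 where C2: "0 \<le> C2" "\<And>x. - V x \<le> C2 * (1 + (norm x)\<^sup>2)"
    using k_convex_lsc_lower_bound[OF V] by blast
  have "0 \<le> real DIM('a) / (real DIM('a) + 2)" by simp
  then have \<alpha>0: "0 < \<alpha>" using \<alpha>(1) by linarith
  define q where "q = \<alpha> / (1 - \<alpha>)"
  have "real DIM('a) < \<alpha> * (real DIM('a) + 2)"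
    using \<alpha>(1) by (simp add: pos_divide_less_eq)
  then have "real DIM('a) * (1 - \<alpha>) < 2 * \<alpha>" by (simp add: algebra_simps)
  then have q: "real DIM('a) < 2 * q"
    using \<alpha>(2) by (simp add: q_def pos_less_divide_eq)
  define I where "I = enn2real (\<integral>\<^sup>+ x. ennreal ((1 + (norm (x :: 'a))\<^sup>2) powr (- q)) \<partial>lborel)"
  have I: "(\<integral>\<^sup>+ x. ennreal ((1 + (norm (x :: 'a))\<^sup>2) powr (- q)) \<partial>lborel) = ennreal I" "0 \<le> I"
    using nn_integral_inverse_power_finite[OF q] by (auto simp: I_def)
  define C where "C = C1 * (2 + I) + C2"
  have "0 \<le> C" using C1 C2 I by (simp add: C_def)
  moreover have "ereal (- C * (1 + m)) \<le> energy F V W \<rho>"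
    if \<rho>: "\<rho> \<in> P2" and m: "0 \<le> m" "(\<integral>\<^sup>+ x. ennreal ((norm x)\<^sup>2) \<partial>\<rho>) \<le> ennreal m" for \<rho> m
  proof (cases "absolutely_continuous lborel \<rho>")
    case False
    then show ?thesis by (simp add: energy_def)
  next
    case True
    interpret \<rho>: prob_space \<rho> using \<rho> by (simp add: P2_iff)
    have s[measurable_cong]: "sets \<rho> = sets borel" using \<rho> by (simp add: P2_iff)
    have moment: "(\<integral>\<^sup>+ x. ennreal (1 + (norm x)\<^sup>2) \<partial>\<rho>) \<le> ennreal (1 + m)"
    proof -
      have "(\<integral>\<^sup>+ x. ennreal (1 + (norm x)\<^sup>2) \<partial>\<rho>) = (\<integral>\<^sup>+ x. 1 + ennreal ((norm x)\<^sup>2) \<partial>\<rho>)"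
        by (intro nn_integral_cong) simp
      also have "\<dots> = 1 + (\<integral>\<^sup>+ x. ennreal ((norm x)\<^sup>2) \<partial>\<rho>)"
        by (subst nn_integral_add) (auto simp: \<rho>.emeasure_space_1)
      also have "\<dots> \<le> 1 + ennreal m" using m(2) by (rule add_left_mono)
      also have "\<dots> = ennreal (1 + m)" using m(1) by simp
      finally show ?thesis .
    qed
    let ?f = "RN_deriv lborel \<rho>"
    have density: "(\<integral>\<^sup>+ x. ?f x * g x \<partial>lborel) = (\<integral>\<^sup>+ x. g x \<partial>\<rho>)"
      if "g \<in> borel_measurable borel" for g
      using sigma_finite_measure.RN_deriv_nn_integral[OF sigma_finite_lborel True, of g] s that by simp
    have "(\<integral>\<^sup>+ x. ennreal (- F (enn2real (?f x))) \<partial>lborel)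
        \<le> (\<integral>\<^sup>+ x. ennreal (2 * C1) * (?f x * ennreal (1 + (norm x)\<^sup>2))
            + ennreal C1 * ennreal ((1 + (norm x)\<^sup>2) powr (- q)) \<partial>lborel)"
    proof (rule nn_integral_mono)
      fix x :: 'a
      define z where "z = enn2real (?f x)"
      define w where "w = 1 + (norm x)\<^sup>2"
      have z: "0 \<le> z" and w: "1 \<le> w" by (auto simp: z_def w_def)
      have "z * 1 \<le> z * w" using z w by (rule mult_left_mono[rotated])
      moreover have "z powr \<alpha> \<le> z * w + w powr (- q)"
        unfolding q_def by (rule powr_le_moment_plus_tail[OF z w \<alpha>0 \<alpha>(2)])
      ultimately have "z + z powr \<alpha> \<le> 2 * (z * w) + w powr (- q)" by linarith
      then have "C1 * (z + z powr \<alpha>) \<le> C1 * (2 * (z * w) + w powr (- q))"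
        using C1(1) by (rule mult_left_mono)
      with C1(2)[OF z] have "- F z \<le> 2 * C1 * (z * w) + C1 * w powr (- q)"
        by (simp add: algebra_simps)
      then have "ennreal (- F z) \<le> ennreal (2 * C1 * (z * w) + C1 * w powr (- q))"
        by (rule ennreal_leI)
      also have "\<dots> = ennreal (2 * C1 * (z * w)) + ennreal (C1 * w powr (- q))"
        using C1 z w by (intro ennreal_plus) auto
      also have "ennreal (C1 * w powr (- q)) = ennreal C1 * ennreal (w powr (- q))"
        using C1 by (intro ennreal_mult) auto
      also have "ennreal (2 * C1 * (z * w)) = ennreal (2 * C1) * (ennreal z * ennreal w)"
        using C1 z w by (simp add: ennreal_mult)
      also have "\<dots> \<le> ennreal (2 * C1) * (?f x * ennreal w)"
      proof -
        have "ennreal z \<le> ?f x" unfolding z_def by (cases "?f x") auto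
        then show ?thesis by (intro mult_left_mono mult_right_mono) auto
      qed
      finally show "ennreal (- F (enn2real (?f x))) \<le> ennreal (2 * C1) * (?f x * ennreal (1 + (norm x)\<^sup>2))
            + ennreal C1 * ennreal ((1 + (norm x)\<^sup>2) powr (- q))"
        by (simp add: z_def w_def add_right_mono)
    qed
    also have "\<dots> = ennreal (2 * C1) * (\<integral>\<^sup>+ x. ennreal (1 + (norm x)\<^sup>2) \<partial>\<rho>) + ennreal C1 * ennreal I"
      by (subst nn_integral_add) (auto simp: nn_integral_cmult density I)
    also have "\<dots> \<le> ennreal (2 * C1) * ennreal (1 + m) + ennreal C1 * ennreal I"
      by (intro add_mono mult_left_mono moment) auto
    also have "\<dots> = ennreal (2 * C1 * (1 + m) + C1 * I)"
      using C1 I m by (simp add: ennreal_mult[symmetric] ennreal_plus[symmetric] del: ennreal_plus)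
    finally have F_ge: "ereal (- (2 * C1 * (1 + m) + C1 * I)) \<le> ext_integral lborel (\<lambda>x. F (enn2real (?f x)))"
      using C1 I m by (intro ext_integral_ge) auto
    have "(\<integral>\<^sup>+ x. ennreal (- V x) \<partial>\<rho>) \<le> (\<integral>\<^sup>+ x. ennreal C2 * ennreal (1 + (norm x)\<^sup>2) \<partial>\<rho>)"
      using C2 by (intro nn_integral_mono) (auto simp: ennreal_mult[symmetric] simp del: ennreal_plus intro!: ennreal_leI)
    also have "\<dots> = ennreal C2 * (\<integral>\<^sup>+ x. ennreal (1 + (norm x)\<^sup>2) \<partial>\<rho>)"
      by (rule nn_integral_cmult) measurable
    also have "\<dots> \<le> ennreal C2 * ennreal (1 + m)"
      by (intro mult_left_mono moment) auto
    also have "\<dots> = ennreal (C2 * (1 + m))"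
      using C2 m by (intro ennreal_mult[symmetric]) auto
    finally have V_ge: "ereal (- (C2 * (1 + m))) \<le> ext_integral \<rho> V"
      using C2 m by (intro ext_integral_ge) auto
    have "ereal (- 0) \<le> ext_integral (\<rho> \<Otimes>\<^sub>M \<rho>) (\<lambda>(x, y). W (x - y))"
      using W by (intro ext_integral_ge) (auto simp: case_prod_beta ennreal_neg)
    then have W_ge: "ereal (1/2) * 0 \<le> ereal (1/2) * ext_integral (\<rho> \<Otimes>\<^sub>M \<rho>) (\<lambda>(x, y). W (x - y))"
      by (intro ereal_mult_left_mono) (auto simp: zero_ereal_def)
    have "C1 * I * 1 \<le> C1 * I * (1 + m)" using C1 I m by (intro mult_left_mono) auto
    then have "- C * (1 + m) \<le> - (2 * C1 * (1 + m) + C1 * I) + - (C2 * (1 + m))"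
      by (simp add: C_def algebra_simps)
    then have "ereal (- C * (1 + m))
        \<le> ereal (- (2 * C1 * (1 + m) + C1 * I)) + ereal (- (C2 * (1 + m))) + ereal (1/2) * 0"
      by simp
    also have "\<dots> \<le> energy F V W \<rho>"
      unfolding energy_def if_P[OF True] by (intro add_mono F_ge V_ge W_ge)
    finally show ?thesis .
  qed
  ultimately show ?thesis using that by blast
qed

section \<open>The comparison principle in the Wasserstein space\<close>

lemma dirac_P2: "return borel (0 :: 'a::euclidean_space) \<in> P2"
  and second_moment_dirac: "(\<integral>\<^sup>+ x. ennreal ((norm x)\<^sup>2) \<partial>return borel (0 :: 'a::euclidean_space)) = 0"
proof -
  show "(\<integral>\<^sup>+ x. ennreal ((norm x)\<^sup>2) \<partial>return borel (0 :: 'a)) = 0"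
    by (subst nn_integral_return) auto
  then show "return borel (0 :: 'a) \<in> P2"
    by (simp add: P2_iff prob_space_return)
qed

text \<open>The Dirac mass at \<open>0\<close> is the reference point: second moments are controlled by the distance to it.\<close>

lemma W2_EVI_length_space:
  fixes F :: "real \<Rightarrow> real" and V W :: "'a::euclidean_space \<Rightarrow> real"
  assumes F: "internal_energy_density DIM('a) F"
    and V: "confinement_potential k V"
    and W: "interaction_potential k' W"
    and flow: "EVI_gradient_flow P2 W2 (energy F V W) \<kappa> S"
  shows "EVI_length_space P2 W2 (energy F V W) S \<kappa>"
proof
  obtain C where C: "0 \<le> C"
    "\<And>\<rho> m. \<rho> \<in> P2 \<Longrightarrow> 0 \<le> m \<Longrightarrow> (\<integral>\<^sup>+ x. ennreal ((norm x)\<^sup>2) \<partial>\<rho>) \<le> ennreal m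
      \<Longrightarrow> ereal (- C * (1 + m)) \<le> energy F V W \<rho>"
    using energy_lower_bound[OF F, of k V W] V W
    by (auto simp: confinement_potential_def interaction_potential_def)
  let ?\<sigma> = "return borel (0 :: 'a)"
  have "ereal (- (5 * C) * (1 + (W2 \<rho> ?\<sigma>)\<^sup>2)) \<le> energy F V W \<rho>" if "\<rho> \<in> P2" for \<rho>
  proof -
    have "(\<integral>\<^sup>+ x. ennreal ((norm x)\<^sup>2) \<partial>\<rho>) \<le> ennreal (2 * (W2 \<rho> ?\<sigma> + 1)\<^sup>2)"
      using second_moment_le[OF that dirac_P2] by (simp add: second_moment_dirac)
    then have "ereal (- C * (1 + 2 * (W2 \<rho> ?\<sigma> + 1)\<^sup>2)) \<le> energy F V W \<rho>"
      by (intro C(2) that) auto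
    moreover have "C * (1 + 2 * (W2 \<rho> ?\<sigma> + 1)\<^sup>2) \<le> C * (5 * (1 + (W2 \<rho> ?\<sigma>)\<^sup>2))"
    proof (rule mult_left_mono[OF _ C(1)])
      have "0 \<le> 2 * (W2 \<rho> ?\<sigma> - 1)\<^sup>2 + (W2 \<rho> ?\<sigma>)\<^sup>2" by simp
      then show "1 + 2 * (W2 \<rho> ?\<sigma> + 1)\<^sup>2 \<le> 5 * (1 + (W2 \<rho> ?\<sigma>)\<^sup>2)"
        by (simp add: power2_eq_square algebra_simps)
    qed
    then have "ereal (- (5 * C) * (1 + (W2 \<rho> ?\<sigma>)\<^sup>2)) \<le> ereal (- C * (1 + 2 * (W2 \<rho> ?\<sigma> + 1)\<^sup>2))"
      by (simp add: mult_ac)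
    ultimately show ?thesis by (rule order_trans[rotated])
  qed
  then show "\<exists>\<sigma>\<in>P2. \<exists>C. \<forall>\<rho>\<in>P2. ereal (- C * (1 + (W2 \<rho> \<sigma>)\<^sup>2)) \<le> energy F V W \<rho>"
    using dirac_P2 by blast
qed (fact W2_nonneg | erule W2_refl | erule (1) W2_sym | erule (2) W2_triangle | erule (2) W2_midpoint | fact flow)+

theorem theorem5p18:
  fixes F :: "real \<Rightarrow> real"
    and V W :: "'a::euclidean_space \<Rightarrow> real"
    and \<kappa>V \<kappa>W \<kappa> lam :: real
    and S :: "real \<Rightarrow> 'a measure \<Rightarrow> 'a measure"
    and h1 h2 u v :: "'a measure \<Rightarrow> real"
  assumes "internal_energy_density DIM('a) F"
    and "confinement_potential \<kappa>V V"
    and "interaction_potential \<kappa>W W"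
    and "\<kappa> = \<kappa>V + \<kappa>W"
    and "EVI_gradient_flow P2 W2 (energy F V W) \<kappa> S"
    and "lam > 0"
    and "bounded (h1 ` P2)" and "uniformly_cont_on P2 W2 h1"
    and "bounded (h2 ` P2)" and "uniformly_cont_on P2 W2 h2"
    and "viscosity_subsolution P2 W2 (H_dagger P2 W2 (energy F V W) S \<kappa>) lam h1 u"
    and "viscosity_supersolution P2 W2 (H_ddagger P2 W2 (energy F V W) S \<kappa>) lam h2 v"
  shows "(SUP \<pi>\<in>P2. u \<pi> - v \<pi>) \<le> (SUP \<pi>\<in>P2. h1 \<pi> - h2 \<pi>)"
proof -
  interpret EVI_length_space P2 W2 "energy F V W" S \<kappa>
    using assms(1-3,5) by (rule W2_EVI_length_space)
  show ?thesis
    using assms(6,7,9-12) by (rule comparison_principle)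
qed

end
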